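(* Let $K_n$ be the number of distinct unordered rooted trees represented by the fringe subtrees of a random recursive tree of size $n$ (fringe subtrees identified if isomorphic as rooted unordered trees). Let $c_{17}=\sum_{k\ge1}\frac{\mathbb{E}(f(T_k))}{k(k+1)}\approx0.9136401430$, where $T_k$ is a random recursive tree with $k$ vertices and $f(t)=\log|t|+\log(m_1!m_2!\cdots m_{k_t}!)$, with $m_1,\dots,m_{k_t}$ the multiplicities of the isomorphism classes (as rooted unordered trees) among the root branches of $t$; and let $c_{18}=\log b\approx1.0837575972$, where $b\approx2.9557652857$ is the exponential growth constant of the number of rooted unordered trees (Pólya trees) with $k$ vertices. Then (i) $c_{17}\frac{n}{\log n}(1+o(1))\le\mathbb{E}(K_n)\le c_{18}\frac{n}{\log n}(1+o(1))$; (ii) with probability tending to $1$, $c_{17}\frac{n}{\log n}(1+o(1))\le K_n\le c_{18}\frac{n}{\log n}(1+o(1))$.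
   Context: A recursive tree of size $n$ is an unordered rooted tree with vertices labelled $1,\dots,n$, labels increasing along paths from the root; a random recursive tree is uniformly chosen among the $(n-1)!$ of them (equivalently, vertex $j$ attaches to a uniformly random earlier vertex). The root branches of $t$ are the subtrees rooted at the children of the root. $|t|$ is the number of vertices. *)

theory Defs
  imports
    "HOL-Library.Multiset"
    "HOL-Library.Landau_Symbols"
    "HOL-Probability.Probability"
begin

text \<open>
  A value of this type is an isomorphism class of finite unordered rooted trees: a root together
  with the multiset of the isomorphism classes of its root branches.
\<close>

datatype utree = Node (branches: "utree multiset")

primrec num_vertices :: "utree \<Rightarrow> nat" where
  "num_vertices (Node B) = Suc (\<Sum>\<^sub># (image_mset num_vertices B))"

definition polya_count :: "nat \<Rightarrow> nat" where
  "polya_count k = card {t. num_vertices t = k}"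

definition polya_growth :: real where
  "polya_growth = lim (\<lambda>k. root k (real (polya_count k)))"

definition c18 :: real where
  "c18 = ln polya_growth"

text \<open>
  \<open>toll t\<close> is $\log |t| + \log (m_1! \cdots m_{k_t}!)$. The distinct isomorphism classes of root
  branches are the elements of the multiset \<open>branches t\<close>, their multiplicities are the counts.
\<close>

definition toll :: "utree \<Rightarrow> real" where
  "toll t = ln (real (num_vertices t)) +
     ln (\<Prod>b\<in>set_mset (branches t). fact (count (branches t) b))"

text \<open>
  A recursive tree with vertices \<open>1, \<dots>, n\<close> is encoded by its parent function: the root is \<open>1\<close> and
  the parent of \<open>j \<ge> 2\<close> is \<open>p j < j\<close>. The value of \<open>p\<close> outside \<open>{2..n}\<close> is fixed to
  \<open>undefined\<close>, so distinct functions are distinct trees.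
\<close>

definition recursive_trees :: "nat \<Rightarrow> (nat \<Rightarrow> nat) set" where
  "recursive_trees n = (\<Pi>\<^sub>E j\<in>{2..n}. {1..<j})"

definition random_recursive_tree :: "nat \<Rightarrow> (nat \<Rightarrow> nat) pmf" where
  "random_recursive_tree n = pmf_of_set (recursive_trees n)"

text \<open>
  \<open>fringe n p v\<close> is the unordered rooted tree represented by the fringe subtree rooted at \<open>v\<close>.
  The restriction to \<open>w > v\<close> loses no children, as \<open>p w < w\<close>; it makes the recursion terminate.
\<close>

function fringe :: "nat \<Rightarrow> (nat \<Rightarrow> nat) \<Rightarrow> nat \<Rightarrow> utree" where
  "fringe n p v = Node (image_mset (fringe n p) (mset_set {w \<in> {v<..n}. p w = v}))"
  by auto
termination
  by (relation "Wellfounded.measure (\<lambda>(n, p, v). n - v)") auto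

declare fringe.simps [simp del]

definition num_fringe :: "nat \<Rightarrow> (nat \<Rightarrow> nat) \<Rightarrow> nat" where
  "num_fringe n p = card (fringe n p ` {1..n})"

definition expected_toll :: "nat \<Rightarrow> real" where
  "expected_toll k = measure_pmf.expectation (random_recursive_tree k) (\<lambda>p. toll (fringe k p 1))"

definition c17 :: real where
  "c17 = (\<Sum>k. expected_toll (Suc k) / (real (Suc k) * real (Suc k + 1)))"

lemma finite_recursive_trees: "finite (recursive_trees n)"
  unfolding recursive_trees_def by (intro finite_PiE) auto

lemma card_recursive_trees: "card (recursive_trees n) = fact (n - 1)"
proof -
  have "card (recursive_trees n) = (\<Prod>j=2..n. j - 1)"
    unfolding recursive_trees_def by (subst card_PiE) auto
  also have "\<dots> = (\<Prod>i=1..n - 1. i)"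
    by (rule prod.reindex_bij_witness[of _ Suc "\<lambda>j. j - 1"]) auto
  finally show ?thesis by (simp add: fact_prod)
qed

lemma recursive_trees_nonempty: "recursive_trees n \<noteq> {}"
  using card_recursive_trees[of n] by auto

lemma set_pmf_random_recursive_tree: "set_pmf (random_recursive_tree n) = recursive_trees n"
  by (simp add: random_recursive_tree_def recursive_trees_nonempty finite_recursive_trees)

lemma num_vertices_pos: "num_vertices t \<ge> 1"
  by (cases t) simp

lemma finite_utrees_le: "finite {t. num_vertices t \<le> k}"
proof (induction k)
  case 0
  have "{t. num_vertices t \<le> 0} = {}"
    using num_vertices_pos by (metis Collect_empty_eq le_zero_eq not_one_le_zero)
  then show ?case by (simp only: finite.emptyI)
next
  case (Suc k)
  let ?A = "{t. num_vertices t \<le> k}"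
  have "t \<in> (Node \<circ> mset) ` {xs. set xs \<subseteq> ?A \<and> length xs \<le> k}" if "num_vertices t \<le> Suc k" for t
  proof (cases t)
    case (Node B)
    have le: "\<Sum>\<^sub># (image_mset num_vertices B) \<le> k"
      using that Node by simp
    have "size B = \<Sum>\<^sub># (image_mset (\<lambda>_. 1) B)" by simp
    also have "\<dots> \<le> \<Sum>\<^sub># (image_mset num_vertices B)"
      by (rule sum_mset_mono) (rule num_vertices_pos)
    finally have size: "size B \<le> k" using le by simp
    have mem: "num_vertices b \<le> k" if "b \<in># B" for b
      using that le by (auto dest!: multi_member_split)
    obtain xs where xs: "B = mset xs" using ex_mset by metis
    have "xs \<in> {xs. set xs \<subseteq> ?A \<and> length xs \<le> k}"
      using size mem xs by auto
    then show ?thesis using xs Node by auto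
  qed
  then have "{t. num_vertices t \<le> Suc k} \<subseteq> (Node \<circ> mset) ` {xs. set xs \<subseteq> ?A \<and> length xs \<le> k}"
    by blast
  then show ?case
    by (rule finite_subset) (intro finite_imageI finite_lists_length_le Suc.IH)
qed

lemma finite_utrees: "finite {t. num_vertices t = k}"
  by (rule finite_subset[OF _ finite_utrees_le[of k]]) auto

text \<open>
  Two fringe subtrees have the same value under \<open>fringe\<close> iff they are isomorphic as rooted
  unordered trees.
\<close>

definition parent_rel :: "nat \<Rightarrow> (nat \<Rightarrow> nat) \<Rightarrow> (nat \<times> nat) set" where
  "parent_rel n p = {(x, p x) | x. x \<in> {2..n}}"

definition fringe_vertices :: "nat \<Rightarrow> (nat \<Rightarrow> nat) \<Rightarrow> nat \<Rightarrow> nat set" where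
  "fringe_vertices n p v = {w. (w, v) \<in> (parent_rel n p)\<^sup>*}"

definition fringe_iso ::
  "nat \<Rightarrow> (nat \<Rightarrow> nat) \<Rightarrow> nat \<Rightarrow> nat \<Rightarrow> (nat \<Rightarrow> nat) \<Rightarrow> nat \<Rightarrow> bool" where
  "fringe_iso n p v m q w \<longleftrightarrow>
     (\<exists>\<phi>. bij_betw \<phi> (fringe_vertices n p v) (fringe_vertices m q w) \<and> \<phi> v = w \<and>
        (\<forall>x\<in>fringe_vertices n p v - {v}. q (\<phi> x) = \<phi> (p x)))"

abbreviation children :: "nat \<Rightarrow> (nat \<Rightarrow> nat) \<Rightarrow> nat \<Rightarrow> nat set" where
  "children n p v \<equiv> {u \<in> {v<..n}. p u = v}"

context
  fixes n :: nat and p :: "nat \<Rightarrow> nat"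
  assumes p: "p \<in> recursive_trees n"
begin

lemma parent_bounds: "x \<in> {2..n} \<Longrightarrow> 1 \<le> p x \<and> p x < x"
  using p by (auto simp: recursive_trees_def PiE_iff)

lemma parent_rel_le: "(x, v) \<in> (parent_rel n p)\<^sup>* \<Longrightarrow> v \<le> x"
  by (induction rule: rtrancl_induct)
    (use parent_bounds in \<open>force simp: parent_rel_def\<close>)+

lemma fringe_vertices_self: "v \<in> fringe_vertices n p v"
  by (simp add: fringe_vertices_def)

lemma fringe_vertices_ge: "x \<in> fringe_vertices n p v \<Longrightarrow> v \<le> x"
  by (simp add: fringe_vertices_def parent_rel_le)

lemma fringe_vertices_step:
  assumes "x \<in> fringe_vertices n p v" "x \<noteq> v"
  shows "x \<in> {2..n}" "p x \<in> fringe_vertices n p v"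
proof -
  have "(x, v) \<in> (parent_rel n p)\<^sup>*" using assms(1) by (simp add: fringe_vertices_def)
  then obtain y where "(x, y) \<in> parent_rel n p" "(y, v) \<in> (parent_rel n p)\<^sup>*"
    using assms(2) by (cases rule: converse_rtranclE) auto
  then show "x \<in> {2..n}" "p x \<in> fringe_vertices n p v"
    by (auto simp: parent_rel_def fringe_vertices_def)
qed

lemma fringe_vertices_stepI:
  "x \<in> {2..n} \<Longrightarrow> p x \<in> fringe_vertices n p v \<Longrightarrow> x \<in> fringe_vertices n p v"
  unfolding fringe_vertices_def mem_Collect_eq
  by (rule converse_rtrancl_into_rtrancl) (auto simp: parent_rel_def)

lemma fringe_vertices_induct [consumes 1, case_names root step]:
  assumes "x \<in> fringe_vertices n p v"
    and "P v"
    and "\<And>x. x \<in> {2..n} \<Longrightarrow> p x \<in> fringe_vertices n p v \<Longrightarrow> P (p x) \<Longrightarrow> P x"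
  shows "P x"
  using assms(1) unfolding fringe_vertices_def mem_Collect_eq
  by (induction rule: converse_rtrancl_induct)
    (use assms(2,3) in \<open>auto simp: parent_rel_def fringe_vertices_def\<close>)

lemma children_eq: "v \<ge> 1 \<Longrightarrow> children n p v = {u \<in> {2..n}. p u = v}"
  using parent_bounds by auto

lemma fringe_vertices_rec:
  assumes "v \<ge> 1"
  shows "fringe_vertices n p v = insert v (\<Union>x\<in>children n p v. fringe_vertices n p x)"
proof (intro equalityI subsetI)
  fix x assume "x \<in> fringe_vertices n p v"
  then show "x \<in> insert v (\<Union>x\<in>children n p v. fringe_vertices n p x)"
  proof (induction rule: fringe_vertices_induct)
    case (step x)
    then consider "p x = v" | y where "y \<in> children n p v" "p x \<in> fringe_vertices n p y" by blast
    then show ?case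
    proof cases
      case 1
      then have "x \<in> children n p v" using step(1) children_eq[OF assms] by blast
      then show ?thesis using fringe_vertices_self by blast
    next
      case 2
      then show ?thesis using fringe_vertices_stepI[OF step(1)] by blast
    qed
  qed auto
next
  fix x assume "x \<in> insert v (\<Union>x\<in>children n p v. fringe_vertices n p x)"
  then consider "x = v" | y where "y \<in> {2..n}" "p y = v" "x \<in> fringe_vertices n p y"
    unfolding children_eq[OF assms] by auto
  then show "x \<in> fringe_vertices n p v"
  proof cases
    case 2
    then have "(y, v) \<in> parent_rel n p" by (auto simp: parent_rel_def)
    with 2(3) show ?thesis by (auto simp: fringe_vertices_def)
  qed (simp add: fringe_vertices_self)
qed

lemma fringe_vertices_disjoint:
  assumes "x \<in> children n p v" "y \<in> children n p v" "x \<noteq> y"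
  shows "fringe_vertices n p x \<inter> fringe_vertices n p y = {}"
proof -
  have no: "a \<notin> fringe_vertices n p b"
    if "a \<in> children n p v" "b \<in> children n p v" "a \<noteq> b" for a b
    using fringe_vertices_step(2)[of a b] fringe_vertices_ge[of v b] that by auto
  have "z \<notin> fringe_vertices n p y" if "z \<in> fringe_vertices n p x" for z
    using that
  proof (induction rule: fringe_vertices_induct)
    case root
    then show ?case using no assms by blast
  next
    case (step z)
    then have "z \<noteq> y"
      using no[of y x] assms fringe_vertices_stepI[of z x] by blast
    then show ?case using step fringe_vertices_step(2) by blast
  qed
  then show ?thesis by blast
qed

end

lemma image_mset_mset_set_eq_bij:
  assumes "finite A" "finite B" "image_mset f (mset_set A) = image_mset g (mset_set B)"
  shows "\<exists>h. bij_betw h A B \<and> (\<forall>x\<in>A. f x = g (h x))"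
  using assms
proof (induction A arbitrary: B rule: finite_induct)
  case empty
  then have "B = {}" by (auto simp: mset_set_empty_iff)
  then show ?case by (auto simp: bij_betw_def)
next
  case (insert a A)
  have "f a \<in># image_mset g (mset_set B)"
    using insert by (metis finite_insert finite_set_mset_mset_set imageI insertI1 set_image_mset)
  then obtain b where b: "b \<in> B" "f a = g b" using insert.prems by auto
  define B' where "B' = B - {b}"
  have B': "B = Set.insert b B'" "b \<notin> B'" "finite B'"
    using b insert.prems by (auto simp: B'_def)
  have "image_mset f (mset_set A) = image_mset g (mset_set B')"
    using insert.prems insert.hyps b B' by simp
  then obtain h where h: "bij_betw h A B'" "\<forall>x\<in>A. f x = g (h x)"
    using insert.IH B' by blast
  have "bij_betw (h(a := b)) (Set.insert a A) B"
    using h(1) insert.hyps B' by (auto simp: bij_betw_def inj_on_def)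
  moreover have "\<forall>x\<in>Set.insert a A. f x = g ((h(a := b)) x)"
    using h(2) b by auto
  ultimately show ?case by blast
qed

lemma fringe_eq_imp_iso:
  assumes "p \<in> recursive_trees n" "q \<in> recursive_trees m" "v \<ge> 1" "w \<ge> 1"
    and "fringe n p v = fringe m q w"
  shows "fringe_iso n p v m q w"
  using assms(3-)
proof (induction "n - v" arbitrary: v w rule: less_induct)
  case less
  note P = assms(1) and Q = assms(2)
  let ?V = "fringe_vertices n p" and ?W = "fringe_vertices m q"
  let ?C = "children n p v" and ?D = "children m q w"
  have eq: "image_mset (fringe n p) (mset_set ?C) = image_mset (fringe m q) (mset_set ?D)"
    using less.prems(3) by (simp add: fringe.simps[of n p v] fringe.simps[of m q w])
  have "\<exists>h. bij_betw h ?C ?D \<and> (\<forall>x\<in>?C. fringe n p x = fringe m q (h x))"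
    by (rule image_mset_mset_set_eq_bij[OF _ _ eq]) simp_all
  then obtain h where h: "bij_betw h ?C ?D" "\<forall>x\<in>?C. fringe n p x = fringe m q (h x)"
    by blast
  have hD: "h x \<in> ?D" if "x \<in> ?C" for x using h(1) that by (rule bij_betwE[THEN bspec])
  have "\<forall>x\<in>?C. fringe_iso n p x m q (h x)"
  proof
    fix x assume x: "x \<in> ?C"
    have "h x \<ge> 1" "x \<ge> 1" "n - x < n - v" using hD[OF x] x by auto
    then show "fringe_iso n p x m q (h x)" using less.hyps h(2) x by blast
  qed
  then have "\<exists>\<phi>. \<forall>x\<in>?C. bij_betw (\<phi> x) (?V x) (?W (h x)) \<and> \<phi> x x = h x \<and>
      (\<forall>y\<in>?V x - {x}. q (\<phi> x y) = \<phi> x (p y))"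
    unfolding fringe_iso_def by (rule bchoice)
  then obtain \<phi> where \<phi>: "\<And>x. x \<in> ?C \<Longrightarrow> bij_betw (\<phi> x) (?V x) (?W (h x))"
      "\<And>x. x \<in> ?C \<Longrightarrow> \<phi> x x = h x"
      "\<And>x y. x \<in> ?C \<Longrightarrow> y \<in> ?V x - {x} \<Longrightarrow> q (\<phi> x y) = \<phi> x (p y)"
    by blast
  define \<Phi> where "\<Phi> y = (if y = v then w else \<phi> (THE x. x \<in> ?C \<and> y \<in> ?V x) y)" for y
  have \<Phi>_v: "\<Phi> v = w" by (simp add: \<Phi>_def)
  have \<Phi>: "\<Phi> y = \<phi> x y" if "x \<in> ?C" "y \<in> ?V x" for x y
  proof -
    have "(THE x. x \<in> ?C \<and> y \<in> ?V x) = x"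
      using that fringe_vertices_disjoint[OF P] by (intro the_equality) blast+
    moreover have "y \<noteq> v" using fringe_vertices_ge[OF P that(2)] that(1) by auto
    ultimately show ?thesis by (simp add: \<Phi>_def)
  qed
  have Vv: "?V v = {v} \<union> (\<Union>x\<in>?C. ?V x)"
    using fringe_vertices_rec[OF P less.prems(1)] by simp
  have "?W w = {w} \<union> (\<Union>x\<in>?D. ?W x)"
    using fringe_vertices_rec[OF Q less.prems(2)] by simp
  also have "?D = h ` ?C" using h(1) by (simp add: bij_betw_def)
  finally have Ww: "?W w = {w} \<union> (\<Union>x\<in>?C. ?W (h x))" by simp
  have bU: "bij_betw \<Phi> (\<Union>x\<in>?C. ?V x) (\<Union>x\<in>?C. ?W (h x))"
  proof (rule bij_betw_UNION_disjoint)
    show "disjoint_family_on (\<lambda>x. ?W (h x)) ?C"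
      unfolding disjoint_family_on_def
    proof (intro ballI impI)
      fix x y assume xy: "x \<in> ?C" "y \<in> ?C" "x \<noteq> y"
      then have "h x \<noteq> h y" using h(1) by (meson bij_betw_def inj_on_def)
      then show "?W (h x) \<inter> ?W (h y) = {}"
        using fringe_vertices_disjoint[OF Q hD hD] xy by blast
    qed
    show "bij_betw \<Phi> (?V x) (?W (h x))" if "x \<in> ?C" for x
      using \<phi>(1)[OF that] \<Phi>[OF that] by (subst bij_betw_cong[of _ _ "\<phi> x"]) auto
  qed
  have "w \<notin> (\<Union>x\<in>?C. ?W (h x))"
    using hD fringe_vertices_ge[OF Q] by fastforce
  then have "bij_betw \<Phi> (?V v) (?W w)"
    unfolding Vv Ww by (intro bij_betw_combine bU) (auto simp: bij_betw_def \<Phi>_v)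
  moreover have "q (\<Phi> y) = \<Phi> (p y)" if y: "y \<in> ?V v - {v}" for y
  proof -
    obtain x where x: "x \<in> ?C" "y \<in> ?V x" using y Vv by blast
    show ?thesis
    proof (cases "y = x")
      case True
      then show ?thesis using x \<Phi>[OF x] \<phi>(2)[OF x(1)] hD[OF x(1)] \<Phi>_v by auto
    next
      case False
      then show ?thesis
        using x \<Phi> \<phi>(3) fringe_vertices_step(2)[OF P x(2)] by auto
    qed
  qed
  ultimately show ?case
    unfolding fringe_iso_def using \<Phi>_v by blast
qed

lemma fringe_iso_imp_eq:
  assumes "p \<in> recursive_trees n" "q \<in> recursive_trees m" "v \<ge> 1" "w \<ge> 1"
    and "fringe_iso n p v m q w"
  shows "fringe n p v = fringe m q w"
  using assms(3-)
proof (induction "n - v" arbitrary: v w rule: less_induct)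
  case less
  note P = assms(1) and Q = assms(2)
  let ?V = "fringe_vertices n p" and ?W = "fringe_vertices m q"
  let ?C = "children n p v" and ?D = "children m q w"
  obtain \<phi> where \<phi>: "bij_betw \<phi> (?V v) (?W w)" "\<phi> v = w"
      "\<And>x. x \<in> ?V v \<Longrightarrow> x \<noteq> v \<Longrightarrow> q (\<phi> x) = \<phi> (p x)"
    using less.prems(3) unfolding fringe_iso_def by blast
  have inj: "inj_on \<phi> (?V v)" and img: "\<phi> ` ?V v = ?W w"
    using \<phi>(1) by (auto simp: bij_betw_def)
  have vV: "v \<in> ?V v" by (rule fringe_vertices_self[OF P])
  have nw: "\<phi> x \<noteq> w" if "x \<in> ?V v" "x \<noteq> v" for x
    using that inj vV \<phi>(2) by (metis inj_onD)
  have CV: "?V x \<subseteq> ?V v" "x \<in> ?V v" "x \<noteq> v" if "x \<in> ?C" for x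
    using fringe_vertices_rec[OF P less.prems(1)] fringe_vertices_self[OF P] that by auto
  have DW: "?W x \<subseteq> ?W w" "x \<in> ?W w" "x \<noteq> w" if "x \<in> ?D" for x
    using fringe_vertices_rec[OF Q less.prems(2)] fringe_vertices_self[OF Q] that by auto
  have toD: "\<phi> x \<in> ?D" if x: "x \<in> ?C" for x
    unfolding children_eq[OF Q less.prems(2)]
    using fringe_vertices_step(1)[OF Q, of "\<phi> x" w] nw[OF CV(2,3)[OF x]] img CV(2)[OF x]
      \<phi>(3)[OF CV(2,3)[OF x]] x \<phi>(2) by auto
  have D: "\<phi> ` ?C = ?D"
  proof (intro equalityI subsetI)
    fix y assume y: "y \<in> ?D"
    then obtain x where x: "x \<in> ?V v" "y = \<phi> x" using DW(2) img by blast
    have xv: "x \<noteq> v" using DW(3)[OF y] x \<phi>(2) by auto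
    have "\<phi> (p x) = \<phi> v" using \<phi>(3)[OF x(1) xv] y x \<phi>(2) by auto
    then have "p x = v"
      using inj fringe_vertices_step(2)[OF P x(1) xv] vV by (meson inj_onD)
    then show "y \<in> \<phi> ` ?C"
      unfolding children_eq[OF P less.prems(1)]
      using fringe_vertices_step(1)[OF P x(1) xv] x by auto
  qed (use toD in blast)
  have sub: "\<phi> ` ?V x = ?W (\<phi> x)" if x: "x \<in> ?C" for x
  proof (intro equalityI subsetI)
    fix z assume "z \<in> \<phi> ` ?V x"
    then obtain y where "y \<in> ?V x" "z = \<phi> y" by blast
    have "\<phi> y \<in> ?W (\<phi> x)" using \<open>y \<in> ?V x\<close>
    proof (induction rule: fringe_vertices_induct[OF P, consumes 1, case_names root step])
      case root
      then show ?case by (rule fringe_vertices_self[OF Q])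
    next
      case (step y)
      have "y \<in> ?V x" using step(1,2) by (rule fringe_vertices_stepI[OF P])
      then have y: "y \<in> ?V v" "y \<noteq> v"
        using CV[OF x] fringe_vertices_ge[OF P, of y x] x by auto
      have "\<phi> y \<in> {2..m}"
        using fringe_vertices_step(1)[OF Q _ nw[OF y]] img y(1) by blast
      moreover have "q (\<phi> y) \<in> ?W (\<phi> x)" using \<phi>(3)[OF y] step.IH by simp
      ultimately show ?case by (rule fringe_vertices_stepI[OF Q])
    qed
    then show "z \<in> ?W (\<phi> x)" using \<open>z = \<phi> y\<close> by simp
  next
    fix z assume "z \<in> ?W (\<phi> x)"
    then show "z \<in> \<phi> ` ?V x"
    proof (induction rule: fringe_vertices_induct[OF Q, consumes 1, case_names root step])
      case root
      then show ?case using fringe_vertices_self[OF P] by blast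
    next
      case (step z)
      have zW: "z \<in> ?W (\<phi> x)" using step(1,2) by (rule fringe_vertices_stepI[OF Q])
      then have "z \<in> ?W w" "z \<noteq> w"
        using DW(1)[OF toD[OF x]] fringe_vertices_ge[OF Q, of z "\<phi> x"] toD[OF x] by auto
      then obtain y where y: "y \<in> ?V v" "z = \<phi> y" "y \<noteq> v" using img \<phi>(2) by blast
      obtain y' where y': "y' \<in> ?V x" "q z = \<phi> y'" using step.IH by blast
      have "\<phi> (p y) = \<phi> y'" using \<phi>(3) y y' by auto
      then have "p y = y'"
        using inj fringe_vertices_step(2)[OF P y(1,3)] y'(1) CV(1)[OF x] by (meson inj_onD subsetD)
      then have "p y \<in> ?V x" using y' by simp
      with fringe_vertices_step(1)[OF P y(1,3)] have "y \<in> ?V x"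
        by (rule fringe_vertices_stepI[OF P])
      then show ?case using y by blast
    qed
  qed
  have eq: "fringe n p x = fringe m q (\<phi> x)" if x: "x \<in> ?C" for x
  proof (rule less.hyps)
    show "n - x < n - v" "x \<ge> 1" using x by auto
    show "\<phi> x \<ge> 1" using toD[OF x] by auto
    have "bij_betw \<phi> (?V x) (?W (\<phi> x))"
      using sub[OF x] inj_on_subset[OF inj CV(1)[OF x]] by (simp add: bij_betw_def)
    moreover have "q (\<phi> y) = \<phi> (p y)" if "y \<in> ?V x - {x}" for y
    proof (rule \<phi>(3))
      show "y \<in> ?V v" using CV(1)[OF x] that by blast
      show "y \<noteq> v" using fringe_vertices_ge[OF P, of y x] that x by auto
    qed
    ultimately show "fringe_iso n p x m q (\<phi> x)"
      unfolding fringe_iso_def by blast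
  qed
  have "inj_on \<phi> ?C" using inj CV(2) by (meson inj_on_def)
  then have "mset_set ?D = image_mset \<phi> (mset_set ?C)"
    using D by (simp add: image_mset_mset_set)
  then have "image_mset (fringe m q) (mset_set ?D) = image_mset (fringe n p) (mset_set ?C)"
    using eq by (auto simp: multiset.map_comp intro!: image_mset_cong)
  then show ?case by (simp add: fringe.simps[of n p v] fringe.simps[of m q w])
qed

lemma fringe_eq_iff_iso:
  assumes "p \<in> recursive_trees n" "q \<in> recursive_trees m" "v \<in> {1..n}" "w \<in> {1..m}"
  shows "fringe n p v = fringe m q w \<longleftrightarrow> fringe_iso n p v m q w"
  using fringe_eq_imp_iso[OF assms(1,2)] fringe_iso_imp_eq[OF assms(1,2)] assms(3,4) by auto

end

theory Submission
  imports Defs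
begin

text \<open>
  The branch of a random recursive tree of size \<open>n\<close> that contains vertex 2 has a uniformly
  distributed size \<open>l\<close> in \<open>{1..n-1}\<close>, and given \<open>l\<close> this branch and the rest are independent random
  recursive trees. For a sum \<open>G\<close> of a bounded toll \<open>g\<close> over all fringe subtrees, this recursion gives
  the mean of \<open>G\<close>, namely \<open>n\<close> times the series of the \<open>E (g T\<^sub>k) / (k (k + 1))\<close> up to a bounded error,
  and a variance of order at most \<open>n * sqrt n\<close>. It also shows that a shape \<open>t\<close> of size \<open>k\<close> has
  probability \<open>k * exp (- F t)\<close>, where \<open>F\<close> sums the toll of the theorem over the fringe subtrees of \<open>t\<close>.

  Upper bound: for \<open>k\<close> slightly below \<open>ln n / c18\<close> there are only \<open>o(n / ln n)\<close> trees with fewer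
  than \<open>k\<close> vertices, and about \<open>n / k\<close> fringe subtrees have at least \<open>k\<close> vertices.

  Lower bound: let \<open>a < c17\<close>, and let \<open>k\<close> be slightly above \<open>ln n / a\<close>. Truncating the toll to small
  trees shows \<open>F T\<^sub>k \<ge> a k\<close> with probability tending to 1, so about \<open>n / k\<close> fringe subtrees have at
  least \<open>k\<close> vertices and a shape of probability at most about \<open>exp (- a k)\<close>. The expected number of
  pairs of these with the same shape is at most \<open>n\<^sup>2\<close> times the sum of the squared probabilities of
  such shapes, hence \<open>o(n / ln n)\<close>, and almost all of them are distinct.
\<close>

subsection \<open>The splitting recursion\<close>

definition leaf :: utree where "leaf = Node {#}"

text \<open>Joins the root of \<open>s\<close> to the root of \<open>r\<close> by an edge. In the
  splitting recursion \<open>s\<close> is the branch of vertex 2 and \<open>r\<close> the rest,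
  which keeps the root.\<close>

definition add_branch :: "utree \<Rightarrow> utree \<Rightarrow> utree" where
  "add_branch s r = Node (add_mset s (branches r))"

text \<open>
  \<open>attach_sum t g\<close> is the sum of \<open>g\<close> over the vertices of \<open>t\<close>, evaluated at the tree obtained by
  attaching a new leaf at that vertex. Quantifying over \<open>g\<close> avoids the multiset of these trees.
\<close>

primrec attach_sum :: "utree \<Rightarrow> (utree \<Rightarrow> real) \<Rightarrow> real" where
  "attach_sum (Node B) = (\<lambda>g. g (Node (add_mset leaf B)) +
     (\<Sum>(b, G)\<in>#image_mset (\<lambda>b. (b, attach_sum b)) B. G (\<lambda>b'. g (Node (add_mset b' (B - {#b#}))))))"

text \<open>The pairs \<open>(b, G)\<close> in the definition only keep \<open>b\<close> available
  next to its recursive call; here they are unfolded away.\<close>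

lemma attach_sum_Node:
  "attach_sum (Node B) g = g (Node (add_mset leaf B)) +
     (\<Sum>b\<in>#B. attach_sum b (\<lambda>b'. g (Node (add_mset b' (B - {#b#})))))"
  by (simp add: multiset.map_comp comp_def)

declare attach_sum.simps [simp del]

lemma attach_sum_leaf: "attach_sum leaf g = g (add_branch leaf leaf)"
  by (simp add: leaf_def add_branch_def attach_sum_Node)

text \<open>The new leaf lands either in the branch \<open>s\<close> or in the rest
  \<open>r\<close>; the root counts as a vertex of \<open>r\<close>.\<close>

lemma attach_sum_add_branch:
  "attach_sum (add_branch s r) g = attach_sum s (\<lambda>s'. g (add_branch s' r)) + attach_sum r (\<lambda>r'. g (add_branch s r'))"
proof (cases r)
  case (Node B)
  have "(\<Sum>b\<in>#B. attach_sum b (\<lambda>b'. g (Node (add_mset b' (add_mset s B - {#b#}))))) =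
        (\<Sum>b\<in>#B. attach_sum b (\<lambda>b'. g (Node (add_mset s (add_mset b' (B - {#b#}))))))"
    by (intro arg_cong[where f = sum_mset] image_mset_cong)
       (auto simp: add_mset_commute diff_union_single_conv)
  then show ?thesis
    by (simp add: Node add_branch_def attach_sum_Node add_mset_commute)
qed

section \<open>Inserting the last vertex into a recursive tree\<close>

lemma fringe_Node:
  "fringe n p v = Node (image_mset (fringe n p) (mset_set (children n p v)))"
  by (subst fringe.simps) simp

lemma fringe_vertices_le:
  assumes "p \<in> recursive_trees n" "v \<le> n" "x \<in> fringe_vertices n p v"
  shows "x \<le> n"
  using fringe_vertices_step(1)[OF assms(1,3)] assms(2) by fastforce

lemma fringe_vertices_root:
  assumes p: "p \<in> recursive_trees n" and "n \<ge> 1"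
  shows "fringe_vertices n p 1 = {1..n}"
proof
  show "fringe_vertices n p 1 \<subseteq> {1..n}"
    using fringe_vertices_le[OF p \<open>n \<ge> 1\<close>] fringe_vertices_ge[OF p] by auto
  have "x \<in> {1..n} \<Longrightarrow> x \<in> fringe_vertices n p 1" for x
  proof (induction x rule: less_induct)
    case (less x)
    show ?case
    proof (cases "x = 1")
      case False
      then have x: "x \<in> {2..n}" using less.prems by auto
      with parent_bounds[OF p this] less show ?thesis
        by (intro fringe_vertices_stepI[OF p x]) auto
    qed (simp add: fringe_vertices_self[OF p])
  qed
  then show "{1..n} \<subseteq> fringe_vertices n p 1" by blast
qed

lemma finite_fringe_vertices:
  assumes "p \<in> recursive_trees n" "v \<le> n"
  shows "finite (fringe_vertices n p v)"
  by (rule finite_subset[of _ "{..n}"]) (use fringe_vertices_le[OF assms] in auto)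

lemma fringe_upd_outside:
  assumes q: "q \<in> recursive_trees n" and "1 \<le> u" "u \<le> n" "v \<le> n" "v \<notin> fringe_vertices n q u"
  shows "fringe (Suc n) (q(Suc n := v)) u = fringe n q u"
  using assms(2-)
proof (induction "n - u" arbitrary: u rule: less_induct)
  case less
  have uv: "u \<noteq> v" using less.prems fringe_vertices_self[OF q] by auto
  have C: "children (Suc n) (q(Suc n := v)) u = children n q u"
    using uv less.prems by (auto simp: le_Suc_eq)
  have "fringe (Suc n) (q(Suc n := v)) x = fringe n q x" if "x \<in> children n q u" for x
  proof (rule less.hyps)
    show "v \<notin> fringe_vertices n q x"
      using less.prems fringe_vertices_rec[OF q, of u] that by auto
  qed (use that less.prems in auto)
  then show ?case
    unfolding fringe_Node[of _ _ u] C by (auto intro!: image_mset_cong)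
qed

text \<open>Links labelled insertion to \<open>attach_sum\<close>: a parent \<open>v = u\<close>
  gives the root a new leaf, and a parent below the child \<open>x\<close> of \<open>u\<close>
  alters only the branch at \<open>x\<close>, where the induction applies.\<close>

lemma sum_fringe_upd:
  assumes q: "q \<in> recursive_trees n" and "1 \<le> u" "u \<le> n"
  shows "(\<Sum>v\<in>fringe_vertices n q u. g (fringe (Suc n) (q(Suc n := v)) u)) =
         attach_sum (fringe n q u) g"
  using assms(2-)
proof (induction "n - u" arbitrary: u g rule: less_induct)
  case less
  let ?V = "fringe_vertices n q" and ?C = "children n q u"
  let ?q = "\<lambda>v. q(Suc n := v)"
  let ?B = "image_mset (fringe n q) (mset_set ?C)"
  have V: "?V u = insert u (\<Union>x\<in>?C. ?V x)" using fringe_vertices_rec[OF q] less.prems by blast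
  have fin: "finite (?V x)" if "x \<in> ?C" for x
    using finite_fringe_vertices[OF q] that by auto
  have notin: "u \<notin> (\<Union>x\<in>?C. ?V x)"
    using fringe_vertices_ge[OF q] by fastforce
  have "(\<Sum>v\<in>?V u. g (fringe (Suc n) (?q v) u)) =
      g (fringe (Suc n) (?q u) u) + (\<Sum>v\<in>(\<Union>x\<in>?C. ?V x). g (fringe (Suc n) (?q v) u))"
    unfolding V using notin fin by (subst sum.insert) auto
  also have "(\<Sum>v\<in>(\<Union>x\<in>?C. ?V x). g (fringe (Suc n) (?q v) u)) =
      (\<Sum>x\<in>?C. \<Sum>v\<in>?V x. g (fringe (Suc n) (?q v) u))"
    by (rule sum.UNION_disjoint) (use fin fringe_vertices_disjoint[OF q] in auto)
  also have "\<dots> = (\<Sum>x\<in>?C. attach_sum (fringe n q x)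
                    (\<lambda>b'. g (Node (add_mset b' (?B - {#fringe n q x#})))))"
  proof (rule sum.cong[OF refl])
    fix x assume x: "x \<in> ?C"
    have "fringe (Suc n) (?q v) u =
        Node (add_mset (fringe (Suc n) (?q v) x) (?B - {#fringe n q x#}))" if v: "v \<in> ?V x" for v
    proof -
      have vx: "x \<le> v" "v \<le> n"
        using fringe_vertices_ge[OF q v] fringe_vertices_le[OF q _ v] x by auto
      have C: "children (Suc n) (?q v) u = ?C"
        using vx x by (auto simp: le_Suc_eq)
      have "fringe (Suc n) (?q v) y = fringe n q y" if "y \<in> ?C - {x}" for y
      proof (rule fringe_upd_outside[OF q])
        show "v \<notin> ?V y" using fringe_vertices_disjoint[OF q, of x u y] that v x by blast
      qed (use that vx in auto)
      then have "image_mset (fringe (Suc n) (?q v)) (mset_set (?C - {x})) =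
          image_mset (fringe n q) (mset_set (?C - {x}))"
        by (auto intro!: image_mset_cong)
      moreover have "mset_set ?C = add_mset x (mset_set (?C - {x}))"
        using x by (simp add: mset_set.remove)
      ultimately show ?thesis
        unfolding fringe_Node[of "Suc n" _ u] C by simp
    qed
    then have "(\<Sum>v\<in>?V x. g (fringe (Suc n) (?q v) u)) =
        (\<Sum>v\<in>?V x. g (Node (add_mset (fringe (Suc n) (?q v) x) (?B - {#fringe n q x#}))))"
      by simp
    also have "\<dots> = attach_sum (fringe n q x)
                    (\<lambda>b'. g (Node (add_mset b' (?B - {#fringe n q x#}))))"
      by (rule less.hyps) (use x less.prems in auto)
    finally show "(\<Sum>v\<in>?V x. g (fringe (Suc n) (?q v) u)) = \<dots>" .
  qed
  also have "\<dots> = (\<Sum>b\<in>#?B. attach_sum b (\<lambda>b'. g (Node (add_mset b' (?B - {#b#})))))"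
    by (simp add: sum_unfold_sum_mset multiset.map_comp comp_def)
  also have "fringe (Suc n) (?q u) u = Node (add_mset leaf ?B)"
  proof -
    have C: "children (Suc n) (?q u) u = insert (Suc n) ?C"
      using less.prems by (auto simp: le_Suc_eq)
    have "fringe (Suc n) (?q u) (Suc n) = leaf"
      by (simp add: fringe_Node[of _ _ "Suc n"] leaf_def)
    moreover have "fringe (Suc n) (?q u) y = fringe n q y" if "y \<in> ?C" for y
      using that less.prems fringe_vertices_ge[OF q, of u y] by (intro fringe_upd_outside[OF q]) auto
    then have "image_mset (fringe (Suc n) (?q u)) (mset_set ?C) = ?B"
      by (auto intro!: image_mset_cong)
    ultimately show ?thesis
      unfolding fringe_Node[of "Suc n" _ u] C by simp
  qed
  finally show ?case
    by (simp only: fringe_Node[of n q u] attach_sum_Node)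
qed

section \<open>Means over random recursive trees\<close>

text \<open>The expectation of \<open>g\<close> at the shape of the random tree, as
  \<open>fact (n - 1)\<close> counts the recursive trees. As a finite sum it needs no integrability
  arguments.\<close>

definition rrt_mean :: "nat \<Rightarrow> (utree \<Rightarrow> real) \<Rightarrow> real" where
  "rrt_mean n g = (\<Sum>p\<in>recursive_trees n. g (fringe n p 1)) / fact (n - 1)"

lemma rrt_mean_one: "rrt_mean 1 g = g leaf"
proof -
  have "recursive_trees 1 = {\<lambda>_. undefined}"
    by (simp add: recursive_trees_def)
  then show ?thesis by (simp add: rrt_mean_def fringe_Node leaf_def)
qed

lemma recursive_trees_Suc:
  assumes "n \<ge> 1"
  shows "recursive_trees (Suc n) = (\<lambda>(v, q). q(Suc n := v)) ` ({1..n} \<times> recursive_trees n)"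
proof -
  have "{2..Suc n} = insert (Suc n) {2..n}" using assms by auto
  moreover have "{1..<Suc n} = {1..n}" by auto
  ultimately show ?thesis
    by (simp add: recursive_trees_def PiE_insert_eq)
qed

lemma inj_on_upd_Suc:
  "inj_on (\<lambda>(v, q). q(Suc n := v)) ({1..n} \<times> recursive_trees n)"
proof -
  have "inj_on (\<lambda>(v, q). q(Suc n := v)) ({1..<Suc n} \<times> (\<Pi>\<^sub>E j\<in>{2..n}. {1..<j}))"
    using inj_combinator[of "Suc n" "{2..n}" "\<lambda>j. {1..<j}"] by simp
  moreover have "{1..<Suc n} = {1..n}" by auto
  ultimately show ?thesis by (simp add: recursive_trees_def)
qed

text \<open>The last vertex chooses its parent uniformly among \<open>n\<close> vertices; the factor
  \<open>n\<close> turns this average into the plain sum \<open>attach_sum\<close>.\<close>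

lemma rrt_mean_Suc:
  assumes "n \<ge> 1"
  shows "real n * rrt_mean (Suc n) g = rrt_mean n (\<lambda>t. attach_sum t g)"
proof -
  have "(\<Sum>p\<in>recursive_trees (Suc n). g (fringe (Suc n) p 1)) =
      (\<Sum>(v, q)\<in>{1..n} \<times> recursive_trees n. g (fringe (Suc n) (q(Suc n := v)) 1))"
    unfolding recursive_trees_Suc[OF assms]
    by (subst sum.reindex[OF inj_on_upd_Suc]) (simp add: case_prod_unfold)
  also have "\<dots> = (\<Sum>q\<in>recursive_trees n. \<Sum>v\<in>{1..n}. g (fringe (Suc n) (q(Suc n := v)) 1))"
    by (subst sum.swap) (simp add: sum.cartesian_product)
  also have "\<dots> = (\<Sum>q\<in>recursive_trees n. attach_sum (fringe n q 1) g)"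
  proof (rule sum.cong[OF refl])
    fix q assume q: "q \<in> recursive_trees n"
    show "(\<Sum>v\<in>{1..n}. g (fringe (Suc n) (q(Suc n := v)) 1)) = attach_sum (fringe n q 1) g"
      using sum_fringe_upd[OF q _ assms, of g] unfolding fringe_vertices_root[OF q assms] by simp
  qed
  finally show ?thesis using assms
    by (simp add: rrt_mean_def fact_reduce[of n])
qed

lemma rrt_mean_add: "rrt_mean n (\<lambda>t. f t + g t) = rrt_mean n f + rrt_mean n g"
  by (simp add: rrt_mean_def sum.distrib add_divide_distrib)

lemma rrt_mean_diff: "rrt_mean n (\<lambda>t. f t - g t) = rrt_mean n f - rrt_mean n g"
  by (simp add: rrt_mean_def sum_subtractf diff_divide_distrib)

lemma rrt_mean_cmult: "rrt_mean n (\<lambda>t. c * g t) = c * rrt_mean n g"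
  by (simp add: rrt_mean_def sum_distrib_left)

lemma rrt_mean_cmult_right: "rrt_mean n (\<lambda>t. g t * c) = rrt_mean n g * c"
  by (simp add: rrt_mean_def sum_distrib_right)

lemma rrt_mean_sum: "rrt_mean n (\<lambda>t. \<Sum>i\<in>I. f i t) = (\<Sum>i\<in>I. rrt_mean n (f i))"
  unfolding rrt_mean_def by (subst sum.swap) (simp add: sum_divide_distrib)

lemma rrt_mean_const: "rrt_mean n (\<lambda>_. c) = c"
  by (simp add: rrt_mean_def card_recursive_trees)

lemma rrt_mean_swap:
  "rrt_mean n (\<lambda>s. rrt_mean m (\<lambda>r. h s r)) = rrt_mean m (\<lambda>r. rrt_mean n (\<lambda>s. h s r))"
  unfolding rrt_mean_def
  by (simp flip: sum_divide_distrib) (subst sum.swap, simp)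

text \<open>
  The branch containing vertex 2 has uniformly distributed size, by Polya's urn.
\<close>

lemma rrt_mean_split_Suc:
  assumes "n \<ge> 1"
  shows "real n * rrt_mean (Suc n) g =
    (\<Sum>l=1..n. rrt_mean l (\<lambda>s. rrt_mean (Suc n - l) (\<lambda>r. g (add_branch s r))))"
  using assms
proof (induction n arbitrary: g rule: nat_induct_at_least)
  case base
  show ?case
    using rrt_mean_Suc[of 1 g] by (simp add: rrt_mean_one[unfolded One_nat_def] attach_sum_leaf)
next
  case (Suc n)
  define A where "A l = rrt_mean l (\<lambda>s. rrt_mean (Suc (Suc n) - l) (\<lambda>r. g (add_branch s r)))" for l
  have A1: "rrt_mean l (\<lambda>s. rrt_mean (Suc n - l) (\<lambda>r. attach_sum s (\<lambda>s'. g (add_branch s' r)))) =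
      real l * A (Suc l)" if "l \<in> {1..n}" for l
    using that
    by (subst rrt_mean_swap)
       (simp add: rrt_mean_Suc[symmetric] rrt_mean_cmult A_def rrt_mean_swap[of "Suc l"])
  have A2: "rrt_mean l (\<lambda>s. rrt_mean (Suc n - l) (\<lambda>r. attach_sum r (\<lambda>r'. g (add_branch s r')))) =
      real (Suc n - l) * A l" if "l \<in> {1..n}" for l
    using that
    by (simp add: rrt_mean_Suc[symmetric] rrt_mean_cmult A_def Suc_diff_le)
  have "real n * (real (Suc n) * rrt_mean (Suc (Suc n)) g) =
      real n * rrt_mean (Suc n) (\<lambda>t. attach_sum t g)"
    by (subst rrt_mean_Suc) auto
  also have "\<dots> = (\<Sum>l=1..n. rrt_mean l (\<lambda>s. rrt_mean (Suc n - l) (\<lambda>r. attach_sum (add_branch s r) g)))"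
    by (rule Suc.IH)
  \<comment> \<open>The urn step: the last vertex enlarges the branch of vertex 2 from
    \<open>l\<close> to \<open>Suc l\<close> in \<open>l\<close> ways, or the rest in
    \<open>Suc n - l\<close> ways.\<close>
  also have "\<dots> = (\<Sum>l=1..n. real l * A (Suc l) + real (Suc n - l) * A l)"
    by (rule sum.cong) (simp_all add: attach_sum_add_branch rrt_mean_add A1 A2)
  also have "\<dots> = (\<Sum>l=1..n. real l * A (Suc l)) + (\<Sum>l=1..n. real (Suc n - l) * A l)"
    by (rule sum.distrib)
  also have "(\<Sum>l=1..n. real l * A (Suc l)) = (\<Sum>l=2..Suc n. real (l - 1) * A l)"
    by (rule sum.reindex_bij_witness[of _ "\<lambda>l. l - 1" Suc]) auto
  \<comment> \<open>The weight \<open>l - 1\<close> vanishes at \<open>l = 1\<close> and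
    \<open>Suc n - l\<close> at \<open>l = Suc n\<close>, so both sums extend to the same range,
    where the weights add up to \<open>n\<close>.\<close>
  also have "\<dots> = (\<Sum>l=1..Suc n. real (l - 1) * A l)"
    by (rule sum.mono_neutral_left) (auto simp: not_le)
  also have "(\<Sum>l=1..n. real (Suc n - l) * A l) = (\<Sum>l=1..Suc n. real (Suc n - l) * A l)"
    by (rule sum.mono_neutral_left) (auto simp: not_le)
  also have "(\<Sum>l=1..Suc n. real (l - 1) * A l) + (\<Sum>l=1..Suc n. real (Suc n - l) * A l) =
      real n * (\<Sum>l=1..Suc n. A l)"
    unfolding sum.distrib[symmetric] sum_distrib_left
    by (rule sum.cong) (auto simp: of_nat_diff algebra_simps)
  finally show ?case
    using Suc.hyps by (simp add: A_def)
qed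

lemma rrt_mean_split:
  assumes "n \<ge> 2"
  shows "rrt_mean n g =
    (\<Sum>l=1..n-1. rrt_mean l (\<lambda>s. rrt_mean (n - l) (\<lambda>r. g (add_branch s r)))) / real (n - 1)"
  using rrt_mean_split_Suc[of "n - 1" g] assms by (simp add: field_simps)

subsection \<open>Additive functionals of fringe subtrees\<close>

primrec fringes :: "utree \<Rightarrow> utree multiset" where
  "fringes (Node B) = add_mset (Node B) (\<Sum>\<^sub># (image_mset fringes B))"

text \<open>All fringe subtrees survive the joining except \<open>r\<close> itself, whose root
  becomes the new root. The additive form avoids multiset subtraction.\<close>

lemma fringes_add_branch:
  "add_mset r (fringes (add_branch s r)) = add_mset (add_branch s r) (fringes s + fringes r)"
  by (cases r) (simp add: add_branch_def add_mset_commute)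

lemma num_vertices_add_branch: "num_vertices (add_branch s r) = num_vertices s + num_vertices r"
  by (cases r) (simp add: add_branch_def)

lemma num_vertices_leaf [simp]: "num_vertices leaf = 1"
  by (simp add: leaf_def)

lemma num_vertices_fringes_le: "x \<in># fringes t \<Longrightarrow> num_vertices x \<le> num_vertices t"
proof (induction t)
  case (Node B)
  show ?case
  proof (cases "x = Node B")
    case False
    then obtain b where b: "b \<in># B" "x \<in># fringes b" using Node.prems by auto
    then have "num_vertices x \<le> num_vertices b" by (rule Node.IH)
    also have "\<dots> \<le> num_vertices (Node B)" using b(1) by (auto dest!: multi_member_split)
    finally show ?thesis .
  qed simp
qed

lemma set_mset_fringes_fringe:
  assumes p: "p \<in> recursive_trees n" and "u \<ge> 1"
  shows "set_mset (fringes (fringe n p u)) = fringe n p ` fringe_vertices n p u"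
  using \<open>u \<ge> 1\<close>
proof (induction "n - u" arbitrary: u rule: less_induct)
  case less
  have "set_mset (fringes (fringe n p x)) = fringe n p ` fringe_vertices n p x"
    if "x \<in> children n p u" for x
    using that less.prems by (intro less.hyps) auto
  moreover have "set_mset (fringes (fringe n p u)) =
      insert (fringe n p u) (\<Union>x\<in>children n p u. set_mset (fringes (fringe n p x)))"
    by (subst (1 2) fringe_Node) auto
  ultimately show ?case
    by (simp add: fringe_vertices_rec[OF p less.prems] image_UN)
qed

definition num_distinct :: "utree \<Rightarrow> nat" where
  "num_distinct t = card (set_mset (fringes t))"

text \<open>Makes the number of distinct fringe subtrees a function of the shape of the whole tree,
  so that \<open>rrt_mean\<close> applies.\<close>

lemma num_fringe_eq:
  assumes "p \<in> recursive_trees n" "n \<ge> 1"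
  shows "num_fringe n p = num_distinct (fringe n p 1)"
  unfolding num_fringe_def num_distinct_def set_mset_fringes_fringe[OF assms(1) order_refl]
    fringe_vertices_root[OF assms] ..

definition tree_sum :: "(utree \<Rightarrow> real) \<Rightarrow> utree \<Rightarrow> real" where
  "tree_sum g t = (\<Sum>x\<in>#fringes t. g x)"

lemma tree_sum_leaf [simp]: "tree_sum g leaf = g leaf"
  by (simp add: tree_sum_def leaf_def)

lemma tree_sum_Node: "tree_sum g (Node B) = g (Node B) + (\<Sum>b\<in>#B. tree_sum g b)"
proof -
  have "(\<Sum>x\<in>#\<Sum>\<^sub># (image_mset fringes B). g x) = (\<Sum>b\<in>#B. \<Sum>x\<in>#fringes b. g x)"
    by (induction B) auto
  then show ?thesis by (simp add: tree_sum_def)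
qed

lemma tree_sum_add_branch:
  "tree_sum g (add_branch s r) = tree_sum g s + tree_sum g r + (g (add_branch s r) - g r)"
  using arg_cong[OF fringes_add_branch, of "\<lambda>M. \<Sum>x\<in>#M. g x" r s] by (simp add: tree_sum_def)

lemma tree_sum_mono: "(\<And>x. f x \<le> g x) \<Longrightarrow> tree_sum f t \<le> tree_sum g t"
  unfolding tree_sum_def by (rule sum_mset_mono)

lemma tree_sum_of_bool_eq: "tree_sum (\<lambda>x. of_bool (x = t0)) t = real (count (fringes t) t0)"
proof -
  have "(\<Sum>x\<in>#M. of_bool (x = t0)) = real (count M t0)" for M
    by (induction M) auto
  then show ?thesis by (simp add: tree_sum_def)
qed

lemma tree_sum_of_bool_mem: "tree_sum (\<lambda>x. of_bool (x \<in> A)) t = real (size {#x \<in># fringes t. x \<in> A#})"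
proof -
  have "(\<Sum>x\<in>#M. of_bool (x \<in> A)) = real (size {#x \<in># M. x \<in> A#})" for M
    by (induction M) auto
  then show ?thesis by (simp add: tree_sum_def)
qed

text \<open>Only trees of size \<open>n\<close> enter the mean. The splitting recursion yields this
  by induction, since sizes add under \<open>add_branch\<close>.\<close>

lemma rrt_mean_cong:
  assumes "n \<ge> 1" "\<And>t. num_vertices t = n \<Longrightarrow> f t = g t"
  shows "rrt_mean n f = rrt_mean n g"
  using assms
proof (induction n arbitrary: f g rule: less_induct)
  case (less n)
  show ?case
  proof (cases "n = 1")
    case True
    then show ?thesis using less.prems by (simp add: rrt_mean_one[unfolded One_nat_def])
  next
    case False
    then have n: "n \<ge> 2" using less.prems by simp
    have "rrt_mean l (\<lambda>s. rrt_mean (n - l) (\<lambda>r. f (add_branch s r))) =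
        rrt_mean l (\<lambda>s. rrt_mean (n - l) (\<lambda>r. g (add_branch s r)))" if "l \<in> {1..n-1}" for l
    proof (rule less.IH)
      fix s assume "num_vertices s = l"
      then show "rrt_mean (n - l) (\<lambda>r. f (add_branch s r)) =
          rrt_mean (n - l) (\<lambda>r. g (add_branch s r))"
        using that by (intro less.IH) (auto simp: num_vertices_add_branch intro!: less.prems)
    qed (use that in auto)
    then show ?thesis unfolding rrt_mean_split[OF n] by simp
  qed
qed

lemma rrt_mean_nonneg:
  assumes "n \<ge> 1" "\<And>t. num_vertices t = n \<Longrightarrow> 0 \<le> f t"
  shows "0 \<le> rrt_mean n f"
proof -
  \<comment> \<open>Values at other sizes do not count, so \<open>f\<close> may be made nonnegative
    everywhere.\<close>
  have "rrt_mean n f = rrt_mean n (\<lambda>t. \<bar>f t\<bar>)"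
    using assms by (intro rrt_mean_cong) auto
  then show ?thesis by (simp add: rrt_mean_def sum_nonneg)
qed

lemma rrt_mean_mono:
  assumes "n \<ge> 1" "\<And>t. num_vertices t = n \<Longrightarrow> f t \<le> g t"
  shows "rrt_mean n f \<le> rrt_mean n g"
  using rrt_mean_nonneg[of n "\<lambda>t. g t - f t"] assms by (simp add: rrt_mean_diff)

lemma rrt_mean_mult:
  "rrt_mean l (\<lambda>s. rrt_mean m (\<lambda>r. f s * h r)) = rrt_mean l f * rrt_mean m h"
  by (simp add: rrt_mean_cmult rrt_mean_cmult_right)

lemma sum_reverse_below:
  assumes "n \<ge> 1"
  shows "(\<Sum>l=1..n-1. x (n - l)) = (\<Sum>l=1..n-(1::nat). x l :: real)"
  by (rule sum.reindex_bij_witness[of _ "\<lambda>l. n - l" "\<lambda>l. n - l"]) (use assms in auto)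

text \<open>The recursion in the form used for second moments: by independence the cross term
  becomes a product of means, and the reflection \<open>l\<close> to \<open>n - l\<close> merges the
  two \<open>a\<close> terms.\<close>

lemma rrt_mean_split_le:
  assumes "n \<ge> 2"
    and "\<And>s r. num_vertices s + num_vertices r = n \<Longrightarrow>
           g (add_branch s r) \<le> a s + a r + c * (b s * b r) + d"
  shows "rrt_mean n g \<le>
    (\<Sum>l=1..n-1. 2 * rrt_mean l a + c * (rrt_mean l b * rrt_mean (n - l) b)) / real (n - 1) + d"
proof -
  have "rrt_mean l (\<lambda>s. rrt_mean (n - l) (\<lambda>r. g (add_branch s r))) \<le>
      rrt_mean l a + rrt_mean (n - l) a + c * (rrt_mean l b * rrt_mean (n - l) b) + d"
    if "l \<in> {1..n-1}" for l
  proof -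
    have "rrt_mean l (\<lambda>s. rrt_mean (n - l) (\<lambda>r. g (add_branch s r))) \<le>
        rrt_mean l (\<lambda>s. rrt_mean (n - l) (\<lambda>r. a s + a r + c * (b s * b r) + d))"
      using that by (intro rrt_mean_mono assms(2)) auto
    then show ?thesis
      by (simp add: rrt_mean_add rrt_mean_const rrt_mean_cmult rrt_mean_cmult_right)
  qed
  then have "(\<Sum>l=1..n-1. rrt_mean l (\<lambda>s. rrt_mean (n - l) (\<lambda>r. g (add_branch s r)))) \<le>
      (\<Sum>l=1..n-1. rrt_mean l a + rrt_mean (n - l) a + c * (rrt_mean l b * rrt_mean (n - l) b) + d)"
    by (rule sum_mono)
  also have "\<dots> = (\<Sum>l=1..n-1. rrt_mean l a) + (\<Sum>l=1..n-1. rrt_mean (n - l) a) +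
      (\<Sum>l=1..n-1. c * (rrt_mean l b * rrt_mean (n - l) b)) + real (n - 1) * d"
    by (simp add: sum.distrib)
  also have "(\<Sum>l=1..n-1. rrt_mean (n - l) a) = (\<Sum>l=1..n-1. rrt_mean l a)"
    by (rule sum_reverse_below) (use assms in simp)
  also have "(\<Sum>l=1..n-1. rrt_mean l a) + (\<Sum>l=1..n-1. rrt_mean l a) +
      (\<Sum>l=1..n-1. c * (rrt_mean l b * rrt_mean (n - l) b)) + real (n - 1) * d =
      (\<Sum>l=1..n-1. 2 * rrt_mean l a + c * (rrt_mean l b * rrt_mean (n - l) b)) + real (n - 1) * d"
    by (simp add: sum.distrib flip: sum_distrib_left)
  finally have "(\<Sum>l=1..n-1. rrt_mean l (\<lambda>s. rrt_mean (n - l) (\<lambda>r. g (add_branch s r)))) /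
      real (n - 1) \<le> ((\<Sum>l=1..n-1. 2 * rrt_mean l a + c * (rrt_mean l b * rrt_mean (n - l) b)) +
      real (n - 1) * d) / real (n - 1)"
    by (rule divide_right_mono) simp
  then show ?thesis
    unfolding rrt_mean_split[OF assms(1)] using assms(1) by (simp add: add_divide_distrib)
qed

text \<open>The recursion solved exactly: on average a tree of size \<open>n\<close> has
  \<open>n / (k (k + 1))\<close> fringe subtrees of size \<open>k\<close> for each
  \<open>k < n\<close>, plus the whole tree.\<close>

lemma rrt_mean_tree_sum:
  "rrt_mean (Suc n) (tree_sum g) =
     real (Suc n) * (\<Sum>k<n. rrt_mean (Suc k) g / (real (Suc k) * real (Suc k + 1))) +
     rrt_mean (Suc n) g"
proof (induction n rule: less_induct)
  case (less n)
  define \<gamma> where "\<gamma> k = rrt_mean k g" for k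
  define P where "P n = (\<Sum>k<n. \<gamma> (Suc k) / (real (Suc k) * real (Suc k + 1)))" for n
  have IH: "rrt_mean l (tree_sum g) = real l * P (l - 1) + \<gamma> l" if "l \<in> {1..n}" for l
  proof -
    have "l - 1 < n" "Suc (l - 1) = l" using that by auto
    then show ?thesis using less[of "l - 1"] by (simp only: P_def \<gamma>_def)
  qed
  show ?case
  proof (cases "n = 0")
    case True
    then show ?thesis by (simp add: rrt_mean_one[unfolded One_nat_def])
  next
    case False
    then have n: "Suc n \<ge> 2" by simp
    \<comment> \<open>The identity that solves the recursion. Each \<open>l\<close> occurs once as
      branch size and once as size of the rest; \<open>- \<gamma> l\<close> removes the toll that
      the rest loses with its root.\<close>
    have id: "(\<Sum>l=1..m. 2 * (real l * P (l - 1) + \<gamma> l) - \<gamma> l) = real m * real (Suc m) * P m" for m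
    proof (induction m)
      case (Suc m)
      have "real (Suc m) * real (Suc (Suc m)) * P (Suc m) =
          real (Suc m) * real (Suc (Suc m)) * P m + \<gamma> (Suc m)"
        by (simp add: P_def distrib_left del: of_nat_Suc)
      then show ?case using Suc by (simp add: algebra_simps)
    qed simp
    have "rrt_mean l (\<lambda>s. rrt_mean (Suc n - l) (\<lambda>r. tree_sum g (add_branch s r))) =
        rrt_mean l (tree_sum g) + (rrt_mean (Suc n - l) (tree_sum g) - \<gamma> (Suc n - l)) +
        rrt_mean l (\<lambda>s. rrt_mean (Suc n - l) (\<lambda>r. g (add_branch s r)))" for l
      by (simp add: tree_sum_add_branch rrt_mean_add rrt_mean_diff rrt_mean_const \<gamma>_def)
    then have "(\<Sum>l=1..n. rrt_mean l (\<lambda>s. rrt_mean (Suc n - l) (\<lambda>r. tree_sum g (add_branch s r)))) =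
        (\<Sum>l=1..n. rrt_mean l (tree_sum g)) +
        (\<Sum>l=1..n. rrt_mean (Suc n - l) (tree_sum g) - \<gamma> (Suc n - l)) +
        (\<Sum>l=1..n. rrt_mean l (\<lambda>s. rrt_mean (Suc n - l) (\<lambda>r. g (add_branch s r))))"
      by (simp only: sum.distrib)
    then have "rrt_mean (Suc n) (tree_sum g) * real n =
        (\<Sum>l=1..n. rrt_mean l (tree_sum g)) +
        (\<Sum>l=1..n. rrt_mean (Suc n - l) (tree_sum g) - \<gamma> (Suc n - l)) + \<gamma> (Suc n) * real n"
      using False unfolding \<gamma>_def[of "Suc n"] rrt_mean_split[OF n] by simp
    also have "(\<Sum>l=1..n. rrt_mean (Suc n - l) (tree_sum g) - \<gamma> (Suc n - l)) =
        (\<Sum>l=1..n. rrt_mean l (tree_sum g) - \<gamma> l)"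
      using sum_reverse_below[of "Suc n" "\<lambda>l. rrt_mean l (tree_sum g) - \<gamma> l"] by simp
    also have "(\<Sum>l=1..n. rrt_mean l (tree_sum g)) + (\<Sum>l=1..n. rrt_mean l (tree_sum g) - \<gamma> l) =
        (\<Sum>l=1..n. 2 * (real l * P (l - 1) + \<gamma> l) - \<gamma> l)"
      unfolding sum.distrib[symmetric] by (rule sum.cong) (simp_all add: IH)
    also have "\<dots> = real n * real (Suc n) * P n" by (rule id)
    finally have "rrt_mean (Suc n) (tree_sum g) * real n = (real (Suc n) * P n + \<gamma> (Suc n)) * real n"
      by (simp add: algebra_simps)
    then show ?thesis using False by (simp add: P_def \<gamma>_def)
  qed
qed

text \<open>The mean toll per vertex in the limit: the fringe subtree at a random vertex has size
  \<open>k\<close> with limiting probability \<open>1 / (k (k + 1))\<close>.\<close>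

definition fringe_density :: "(utree \<Rightarrow> real) \<Rightarrow> real" where
  "fringe_density g = (\<Sum>k. rrt_mean (Suc k) g / (real (Suc k) * real (Suc k + 1)))"

lemma c17_eq: "c17 = fringe_density toll"
  unfolding c17_def fringe_density_def expected_toll_def rrt_mean_def random_recursive_tree_def
  by (simp add: integral_pmf_of_set recursive_trees_nonempty finite_recursive_trees
        card_recursive_trees)

lemma telescope_sums:
  "(\<lambda>k. 1 / (real (Suc (k + n)) * real (Suc (k + n) + 1))) sums (1 / real (Suc n))"
proof -
  have "(\<lambda>k. 1 / real (Suc (k + n))) \<longlonglongrightarrow> 0" by real_asymp
  from telescope_sums'[OF this]
  have "(\<lambda>k. 1 / real (Suc (k + n)) - 1 / real (Suc (Suc k + n))) sums (1 / real (Suc n) - 0)"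
    by simp
  moreover have "1 / real (Suc (k + n)) - 1 / real (Suc (Suc k + n)) =
      1 / (real (Suc (k + n)) * real (Suc (k + n) + 1))" for k
    by (simp add: field_simps)
  ultimately show ?thesis by simp
qed

context
  fixes g :: "utree \<Rightarrow> real" and C :: real
  assumes g: "\<And>t. 0 \<le> g t" "\<And>t. g t \<le> C"
begin

lemma rrt_mean_bounds: "0 \<le> rrt_mean (Suc k) g" "rrt_mean (Suc k) g \<le> C"
  using rrt_mean_nonneg[of "Suc k" g] rrt_mean_mono[of "Suc k" g "\<lambda>_. C"] g
  by (auto simp: rrt_mean_const)

lemma density_term_bounds:
  "0 \<le> rrt_mean (Suc k) g / (real (Suc k) * real (Suc k + 1))"
  "rrt_mean (Suc k) g / (real (Suc k) * real (Suc k + 1)) \<le> C * (1 / (real (Suc k) * real (Suc k + 1)))"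
  using rrt_mean_bounds by (auto intro!: divide_right_mono)

lemma summable_fringe_density:
  "summable (\<lambda>k. rrt_mean (Suc k) g / (real (Suc k) * real (Suc k + 1)))"
proof (rule summable_comparison_test')
  show "summable (\<lambda>k. C * (1 / (real (Suc k) * real (Suc k + 1))))"
    using telescope_sums[of 0] by (intro summable_mult) (auto simp: summable_def)
  show "norm (rrt_mean (Suc k) g / (real (Suc k) * real (Suc k + 1))) \<le>
      C * (1 / (real (Suc k) * real (Suc k + 1)))" if "k \<ge> 0" for k
    using density_term_bounds[of k] by (simp only: real_norm_def abs_of_nonneg)
qed

text \<open>The exact mean differs from the full series by the root term minus \<open>n\<close>
  times the tail. Both lie between 0 and \<open>C\<close>, so their difference is at most
  \<open>C\<close> in absolute value.\<close>

lemma rrt_mean_tree_sum_bound: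
  assumes "n \<ge> 1"
  shows "\<bar>rrt_mean n (tree_sum g) - real n * fringe_density g\<bar> \<le> C"
proof -
  obtain m where m: "n = Suc m" using assms by (cases n) auto
  define T where "T = (\<Sum>k. rrt_mean (Suc (k + m)) g / (real (Suc (k + m)) * real (Suc (k + m) + 1)))"
  have "fringe_density g = T + (\<Sum>k<m. rrt_mean (Suc k) g / (real (Suc k) * real (Suc k + 1)))"
    unfolding fringe_density_def T_def by (rule suminf_split_initial_segment[OF summable_fringe_density])
  then have "rrt_mean n (tree_sum g) - real n * fringe_density g = rrt_mean n g - real n * T"
    unfolding m rrt_mean_tree_sum by (simp add: algebra_simps)
  moreover have summ: "summable (\<lambda>k. rrt_mean (Suc (k + m)) g / (real (Suc (k + m)) * real (Suc (k + m) + 1)))"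
    using summable_ignore_initial_segment[OF summable_fringe_density, of m] by simp
  have "0 \<le> T" unfolding T_def using density_term_bounds(1) by (intro suminf_nonneg[OF summ])
  moreover have "T \<le> C * (1 / real (Suc m))"
    unfolding T_def
    using density_term_bounds(2) summ sums_mult[OF telescope_sums[of m], of C]
    by (intro sums_le[OF _ summable_sums[OF summ]]) 
  then have "real n * T \<le> C" unfolding m by (simp add: field_simps)
  ultimately show ?thesis
    using rrt_mean_bounds[of m] mult_nonneg_nonneg[of "real n" T] unfolding m abs_le_iff by linarith
qed

end

text \<open>Comparison with the integral of \<open>x * sqrt x\<close> would give the constant 2/5 in
  the limit; 41/100 leaves room for an elementary proof.\<close>

lemma sum_mult_sqrt_le:
  assumes "n \<ge> 2"
  shows "(\<Sum>l=1..n-1. real l * sqrt (real l)) / real (n - 1) \<le> 41 / 100 * (real n * sqrt (real n))"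
proof -
  \<comment> \<open>The tangent to the square root at \<open>l = 16/25 * n\<close>. It makes the sum
    polynomial, with leading constant 5/24 + 1/5 = 49/120, below 41/100.\<close>
  have am_gm: "sqrt (real l) * sqrt (real n) \<le> 5 / 8 * real l + 2 / 5 * real n" for l
    using zero_le_power2[of "5 * sqrt (real l) - 4 * sqrt (real n)"]
    by (simp add: power2_diff power_mult_distrib)
  have sums: "(\<Sum>l=1..m. real l * (5 / 8 * real l + 2 / 5 * real n)) =
      real m * (real m + 1) * (5 * (2 * real m + 1) / 48 + real n / 5)" for m
    by (induction m) (simp_all add: field_simps)
  have "(\<Sum>l=1..n-1. real l * sqrt (real l)) * sqrt (real n) =
      (\<Sum>l=1..n-1. real l * (sqrt (real l) * sqrt (real n)))"
    by (simp add: sum_distrib_right mult.assoc)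
  also have "\<dots> \<le> (\<Sum>l=1..n-1. real l * (5 / 8 * real l + 2 / 5 * real n))"
    using am_gm by (intro sum_mono mult_left_mono) auto
  also have "\<dots> = real (n - 1) * (real n * (5 * (2 * real n - 1) / 48 + real n / 5))"
  proof -
    have "real (n - 1) + 1 = real n" "2 * real (n - 1) + 1 = 2 * real n - 1"
      using assms by (simp_all add: of_nat_diff)
    then show ?thesis by (simp only: sums mult.assoc)
  qed
  also have "\<dots> \<le> real (n - 1) * (real n * (41 / 100 * real n))"
    by (intro mult_left_mono) auto
  also have "\<dots> = (real (n - 1) * (41 / 100 * (real n * sqrt (real n)))) * sqrt (real n)"
    by (simp add: mult.assoc)
  finally have "(\<Sum>l=1..n-1. real l * sqrt (real l)) * sqrt (real n) \<le>
      (real (n - 1) * (41 / 100 * (real n * sqrt (real n)))) * sqrt (real n)"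
    .
  then have "(\<Sum>l=1..n-1. real l * sqrt (real l)) \<le> real (n - 1) * (41 / 100 * (real n * sqrt (real n)))"
    using assms by (subst (asm) mult_le_cancel_right_pos) auto
  then show ?thesis
    using assms by (simp add: field_simps)
qed

text \<open>
  The recursion multiplies a bound \<open>l * sqrt l\<close> by \<open>11/5 * 41/100 < 1\<close>; any exponent strictly
  between 1 and 2 would do, since only a bound of smaller order than \<open>n\<^sup>2 / (ln n)\<^sup>2\<close> is needed.
\<close>

lemma rrt_mean_tree_sum_deviation:
  assumes g: "\<And>t. 0 \<le> g t" "\<And>t. g t \<le> C" and "n \<ge> 1"
  shows "rrt_mean n (\<lambda>t. (tree_sum g t - fringe_density g * real (num_vertices t))\<^sup>2)
           \<le> 140 * C\<^sup>2 * (real n * sqrt (real n))"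
  using \<open>n \<ge> 1\<close>
proof (induction n rule: less_induct)
  case (less n)
  define H where "H t = tree_sum g t - fringe_density g * real (num_vertices t)" for t
  have C: "0 \<le> C" using g[of leaf] by linarith
  \<comment> \<open>Centring keeps the means of \<open>H\<close> bounded, so the product of means in
    the recursion contributes only a constant.\<close>
  have e: "\<bar>rrt_mean m H\<bar> \<le> C" if "m \<ge> 1" for m
  proof -
    have "rrt_mean m H = rrt_mean m (\<lambda>t. tree_sum g t - real m * fringe_density g)"
      using that by (intro rrt_mean_cong) (auto simp: H_def)
    then show ?thesis
      using rrt_mean_tree_sum_bound[OF g that] by (simp add: rrt_mean_diff rrt_mean_const)
  qed
  show ?case
  proof (cases "n = 1")
    case True
    have "(H leaf)\<^sup>2 \<le> C\<^sup>2"
      using e[of 1] C abs_le_square_iff[of "H leaf" C]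
      by (simp add: rrt_mean_one[unfolded One_nat_def])
    also have "C\<^sup>2 \<le> 140 * C\<^sup>2" by simp
    finally show ?thesis
      using True by (simp add: rrt_mean_one[unfolded One_nat_def] H_def)
  next
    case False
    then have n: "n \<ge> 2" using less.prems by simp
    \<comment> \<open>Weighting the mixed term by
      \<open>2 * x * \<Delta> \<le> x^2 / 10 + 10 * \<Delta>^2\<close> keeps the factor of the
      square near 1, which the contraction requires.\<close>
    have step: "(H (add_branch s r))\<^sup>2 \<le> 11 / 10 * (H s)\<^sup>2 + 11 / 10 * (H r)\<^sup>2 + 11 / 5 * (H s * H r) + 11 * C\<^sup>2"
      for s r
    proof -
      define \<Delta> where "\<Delta> = g (add_branch s r) - g r"
      have "\<bar>\<Delta>\<bar> \<le> \<bar>C\<bar>"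
        using g(1)[of "add_branch s r"] g(2)[of "add_branch s r"] g(1)[of r] g(2)[of r]
        by (simp add: \<Delta>_def abs_le_iff)
      then have "\<Delta>\<^sup>2 \<le> C\<^sup>2" by (simp add: abs_le_square_iff)
      moreover have "(H s + H r + \<Delta>)\<^sup>2 \<le> 11 / 10 * (H s + H r)\<^sup>2 + 11 * \<Delta>\<^sup>2"
        using zero_le_power2[of "H s + H r - 10 * \<Delta>"]
        by (simp add: power2_eq_square algebra_simps)
      moreover have "H (add_branch s r) = H s + H r + \<Delta>"
        by (simp add: H_def tree_sum_add_branch num_vertices_add_branch \<Delta>_def algebra_simps)
      ultimately show ?thesis by (simp add: power2_eq_square algebra_simps)
    qed
    define Q where "Q m = rrt_mean m (\<lambda>t. (H t)\<^sup>2)" for m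
    have "Q n \<le> (\<Sum>l=1..n-1. 2 * rrt_mean l (\<lambda>t. 11 / 10 * (H t)\<^sup>2) +
        11 / 5 * (rrt_mean l H * rrt_mean (n - l) H)) / real (n - 1) + 11 * C\<^sup>2"
      unfolding Q_def
      by (rule rrt_mean_split_le[OF n, where a = "\<lambda>t. 11 / 10 * (H t)\<^sup>2" and b = H]) (rule step)
    also have "\<dots> \<le> (\<Sum>l=1..n-1. 308 * C\<^sup>2 * (real l * sqrt (real l)) + 11 / 5 * C\<^sup>2) / real (n - 1) + 11 * C\<^sup>2"
    proof (intro add_mono divide_right_mono sum_mono)
      fix l assume l: "l \<in> {1..n-1}"
      have "Q l \<le> 140 * C\<^sup>2 * (real l * sqrt (real l))"
        unfolding Q_def H_def by (rule less.IH) (use l in auto)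
      then show "2 * rrt_mean l (\<lambda>t. 11 / 10 * (H t)\<^sup>2) \<le> 308 * C\<^sup>2 * (real l * sqrt (real l))"
        unfolding rrt_mean_cmult by (simp add: Q_def mult_ac)
      have "rrt_mean l H * rrt_mean (n - l) H \<le> \<bar>rrt_mean l H\<bar> * \<bar>rrt_mean (n - l) H\<bar>"
        by (metis abs_ge_self abs_mult)
      also have "\<dots> \<le> C * C" using l by (intro mult_mono e C) auto
      finally show "11 / 5 * (rrt_mean l H * rrt_mean (n - l) H) \<le> 11 / 5 * C\<^sup>2"
        by (simp add: power2_eq_square)
    qed auto
    also have "\<dots> = 308 * C\<^sup>2 * ((\<Sum>l=1..n-1. real l * sqrt (real l)) / real (n - 1)) + 66 / 5 * C\<^sup>2"
    proof -
      have "real (n - 1) \<noteq> 0" using n by simp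
      then have "real (n - 1) * (11 / 5 * C\<^sup>2) / real (n - 1) = 11 / 5 * C\<^sup>2"
        by (rule nonzero_mult_div_cancel_left)
      moreover have "(\<Sum>l=1..n-1. 308 * C\<^sup>2 * (real l * sqrt (real l)) + 11 / 5 * C\<^sup>2) =
          308 * C\<^sup>2 * (\<Sum>l=1..n-1. real l * sqrt (real l)) + real (n - 1) * (11 / 5 * C\<^sup>2)"
        by (simp add: sum.distrib flip: sum_distrib_left)
      ultimately show ?thesis by (simp only: add_divide_distrib) simp
    qed
    also have "\<dots> \<le> 308 * C\<^sup>2 * (41 / 100 * (real n * sqrt (real n))) + 66 / 5 * C\<^sup>2 * (real n * sqrt (real n))"
    proof (intro add_mono mult_left_mono sum_mult_sqrt_le n)
      have "1 * 1 \<le> real n * sqrt (real n)" using n by (intro mult_mono) auto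
      then show "66 / 5 * C\<^sup>2 \<le> 66 / 5 * C\<^sup>2 * (real n * sqrt (real n))"
        using mult_left_mono[of 1 "real n * sqrt (real n)" "66 / 5 * C\<^sup>2"] by simp
    qed auto
    \<comment> \<open>Here \<open>308 = 140 * 11/5\<close>, and 308 * 41/100 + 66/5 = 139.48, so the
      constant 140 reproduces itself.\<close>
    also have "\<dots> \<le> 140 * C\<^sup>2 * (real n * sqrt (real n))"
    proof -
      have "0 \<le> C\<^sup>2 * (real n * sqrt (real n))" by simp
      then show ?thesis by linarith
    qed
    finally show ?thesis by (simp add: Q_def H_def)
  qed
qed

subsection \<open>The probability of a given shape\<close>

definition tree_prob :: "utree \<Rightarrow> real" where
  "tree_prob t = rrt_mean (num_vertices t) (\<lambda>x. of_bool (x = t))"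

lemma tree_prob_nonneg: "0 \<le> tree_prob t"
  using num_vertices_pos by (auto simp: tree_prob_def intro: rrt_mean_nonneg)

lemma rrt_mean_of_bool_eq:
  assumes "n \<ge> 1"
  shows "rrt_mean n (\<lambda>x. of_bool (x = t)) = (if num_vertices t = n then tree_prob t else 0)"
proof (cases "num_vertices t = n")
  case False
  then have "rrt_mean n (\<lambda>x. of_bool (x = t)) = rrt_mean n (\<lambda>_. 0)"
    using assms by (intro rrt_mean_cong) auto
  then show ?thesis using False by (simp add: rrt_mean_const)
qed (simp add: tree_prob_def)

lemma rrt_mean_eq_sum:
  assumes "n \<ge> 1"
  shows "rrt_mean n g = (\<Sum>t\<in>{t. num_vertices t = n}. tree_prob t * g t)"
proof -
  have "rrt_mean n g = rrt_mean n (\<lambda>x. \<Sum>t\<in>{t. num_vertices t = n}. of_bool (x = t) * g t)"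
  proof (rule rrt_mean_cong[OF assms])
    fix x assume "num_vertices x = n"
    then show "g x = (\<Sum>t\<in>{t. num_vertices t = n}. of_bool (x = t) * g t)"
      by (subst sum.remove[of _ x]) (auto simp: finite_utrees intro!: sum.neutral)
  qed
  then show ?thesis
    by (simp add: rrt_mean_sum rrt_mean_cmult_right rrt_mean_of_bool_eq[OF assms])
qed

text \<open>Conditions on the shape \<open>b\<close> of the branch of vertex 2. Each isomorphism
  class in \<open>B\<close> allows exactly one split, hence a sum over the set and not the
  multiset.\<close>

lemma tree_prob_Node:
  assumes "B \<noteq> {#}"
  shows "real (num_vertices (Node B) - 1) * tree_prob (Node B) =
    (\<Sum>b\<in>set_mset B. tree_prob b * tree_prob (Node (B - {#b#})))"
proof -
  define n where "n = num_vertices (Node B)"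
  have nv: "num_vertices b + num_vertices (Node (B - {#b#})) = n" if "b \<in># B" for b
    using that by (auto simp: n_def dest!: multi_member_split)
  obtain b where "b \<in># B" using assms by auto
  from nv[OF this] have n: "n \<ge> 2"
    using num_vertices_pos[of b] num_vertices_pos[of "Node (B - {#b#})"] by linarith
  have "(of_bool (add_branch s r = Node B) :: real) =
      (\<Sum>b\<in>set_mset B. of_bool (s = b) * of_bool (r = Node (B - {#b#})))" for s r
  proof (cases "add_branch s r = Node B")
    case True
    then have "s \<in># B" "r = Node (B - {#s#})" by (cases r; auto simp: add_branch_def)+
    then show ?thesis
      using True by (subst sum.remove[of _ s]) (auto intro!: sum.neutral)
  next
    case False
    then have "\<not> (s = b \<and> r = Node (B - {#b#}))" if "b \<in># B" for b
      using that by (auto simp: add_branch_def)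
    then show ?thesis using False by (auto intro!: sum.neutral[symmetric])
  qed
  then have "real (n - 1) * rrt_mean n (\<lambda>t. of_bool (t = Node B)) =
      (\<Sum>l=1..n-1. \<Sum>b\<in>set_mset B. rrt_mean l (\<lambda>s. of_bool (s = b)) *
         rrt_mean (n - l) (\<lambda>r. of_bool (r = Node (B - {#b#}))))"
    using n unfolding rrt_mean_split[OF n] by (simp only: rrt_mean_sum rrt_mean_mult) simp
  also have "\<dots> = (\<Sum>b\<in>set_mset B. \<Sum>l=1..n-1. rrt_mean l (\<lambda>s. of_bool (s = b)) *
         rrt_mean (n - l) (\<lambda>r. of_bool (r = Node (B - {#b#}))))"
    by (rule sum.swap)
  also have "\<dots> = (\<Sum>b\<in>set_mset B. tree_prob b * tree_prob (Node (B - {#b#})))"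
  proof (rule sum.cong[OF refl])
    fix b assume b: "b \<in># B"
    have "num_vertices b \<in> {1..n-1}"
      using nv[OF b] num_vertices_pos[of b] num_vertices_pos[of "Node (B - {#b#})"] by auto
    moreover have "rrt_mean l (\<lambda>s. of_bool (s = b)) * rrt_mean (n - l) (\<lambda>r. of_bool (r = Node (B - {#b#})))
        = (if l = num_vertices b then tree_prob b * tree_prob (Node (B - {#b#})) else 0)"
      if "l \<in> {1..n-1}" for l
      using that nv[OF b] by (auto simp: rrt_mean_of_bool_eq)
    ultimately show "(\<Sum>l=1..n-1. rrt_mean l (\<lambda>s. of_bool (s = b)) *
         rrt_mean (n - l) (\<lambda>r. of_bool (r = Node (B - {#b#})))) = tree_prob b * tree_prob (Node (B - {#b#}))"
      by simp
  qed
  finally show ?thesis by (simp add: tree_prob_def n_def)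
qed

lemma prod_mset_remove_fact:
  assumes "b \<in># B"
  shows "(\<Prod>x\<in>set_mset B. fact (count B x) :: real) =
    real (count B b) * (\<Prod>x\<in>set_mset (B - {#b#}). fact (count (B - {#b#}) x))"
proof -
  let ?B = "B - {#b#}"
  have "(\<Prod>x\<in>set_mset ?B. fact (count ?B x) :: real) = (\<Prod>x\<in>set_mset B. fact (count ?B x))"
    by (rule prod.mono_neutral_left) (auto dest: in_diffD simp: not_in_iff)
  also have "\<dots> = fact (count B b - 1) * (\<Prod>x\<in>set_mset B - {b}. fact (count B x))"
    using assms by (subst prod.remove[of _ b]) (auto intro!: prod.cong split: if_splits)
  finally have "real (count B b) * (\<Prod>x\<in>set_mset ?B. fact (count ?B x)) =
      fact (count B b) * (\<Prod>x\<in>set_mset B - {b}. fact (count B x))"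
    using assms by (simp add: fact_reduce[of "count B b"] flip: count_greater_zero_iff)
  also have "\<dots> = (\<Prod>x\<in>set_mset B. fact (count B x))"
    using assms by (subst prod.remove[of _ b]) auto
  finally show ?thesis ..
qed

lemma exp_tree_sum_toll_Node:
  "exp (- tree_sum toll (Node B)) =
     (\<Prod>b\<in>#B. exp (- tree_sum toll b)) /
     (real (num_vertices (Node B)) * (\<Prod>x\<in>set_mset B. fact (count B x)))"
proof -
  have "exp (toll (Node B)) = real (num_vertices (Node B)) * (\<Prod>x\<in>set_mset B. fact (count B x))"
    using num_vertices_pos[of "Node B"] by (simp add: toll_def exp_add prod_pos del: num_vertices.simps)
  moreover have "exp (- (\<Sum>b\<in>#B. tree_sum toll b)) = (\<Prod>b\<in>#B. exp (- tree_sum toll b))"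
    by (induction B) (simp_all add: exp_add exp_diff exp_minus field_simps)
  moreover have "exp (- (x + y)) = exp (- y) / exp x" for x y :: real
    by (simp add: exp_diff exp_minus field_simps)
  ultimately show ?thesis by (simp only: tree_sum_Node)
qed

lemma sum_mset_eq_sum_count:
  "real (\<Sum>b\<in>#B. f b) = (\<Sum>b\<in>set_mset B. real (count B b) * real (f b))"
proof -
  have "(\<Sum>b\<in>#B. f b) = (\<Sum>b\<in>A. count B b * f b)" if "finite A" "set_mset B \<subseteq> A" for A
    using that(2)
  proof (induction B)
    case (add x B)
    have "(\<Sum>b\<in>A. count (add_mset x B) b * f b) = (\<Sum>b\<in>A. count B b * f b + (if b = x then f b else 0))"
      by (rule sum.cong) auto
    then show ?case using add that(1) by (simp add: sum.distrib)
  qed simp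
  from this[of "set_mset B"] show ?thesis by simp
qed

text \<open>A hook length formula: \<open>exp (tree_sum toll t)\<close> is the product of all fringe
  subtree sizes times the number of automorphisms, so \<open>t\<close> has
  \<open>n! * exp (- tree_sum toll t)\<close> increasing labellings out of \<open>(n - 1)!\<close>
  recursive trees.\<close>

lemma tree_prob_eq: "tree_prob t = real (num_vertices t) * exp (- tree_sum toll t)"
proof (induction "num_vertices t" arbitrary: t rule: less_induct)
  case less
  obtain B where t: "t = Node B" by (cases t)
  show ?case
  proof (cases "B = {#}")
    case True
    then have "t = leaf" by (simp add: t leaf_def)
    then show ?thesis
      by (simp add: tree_prob_def rrt_mean_one[unfolded One_nat_def]) (simp add: toll_def leaf_def)
  next
    case False
    define F where "F = (\<Prod>x\<in>set_mset B. fact (count B x) :: real)"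
    define W where "W = (\<Prod>b\<in>#B. exp (- tree_sum toll b))"
    have F: "F > 0" by (simp add: F_def prod_pos)
    \<comment> \<open>The size of the reduced tree cancels against its own root toll, and the
      multiplicity of \<open>b\<close> appears. The sizes weighted by multiplicity then sum to
      \<open>num_vertices t - 1\<close>.\<close>
    have "tree_prob b * tree_prob (Node (B - {#b#})) =
        real (num_vertices b) * real (count B b) * (W / F)" if b: "b \<in># B" for b
    proof -
      have nv: "num_vertices b + num_vertices (Node (B - {#b#})) = num_vertices t"
        using b by (auto simp: t dest!: multi_member_split)
      then have "num_vertices b < num_vertices t" "num_vertices (Node (B - {#b#})) < num_vertices t"
        using num_vertices_pos[of b] num_vertices_pos[of "Node (B - {#b#})"] by linarith+
      note IH = less.hyps[OF this(1)] less.hyps[OF this(2)]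
      have W: "W = exp (- tree_sum toll b) * (\<Prod>b\<in>#B - {#b#}. exp (- tree_sum toll b))"
        using b by (auto simp: W_def dest!: multi_member_split)
      have F': "F = real (count B b) * (\<Prod>x\<in>set_mset (B - {#b#}). fact (count (B - {#b#}) x))"
        unfolding F_def by (rule prod_mset_remove_fact[OF b])
      have cancel: "k * x * (m * (w / (m * f))) = k * c * (x * w / (c * f))"
        if "m > 0" "c > 0" for k x m w f c :: real
        using that by (simp add: field_simps)
      show ?thesis
        unfolding IH exp_tree_sum_toll_Node[of "B - {#b#}"] F' W
        by (rule cancel) (use b num_vertices_pos[of "Node (B - {#b#})"] in \<open>simp_all del: num_vertices.simps\<close>)
    qed
    then have "real (num_vertices t - 1) * tree_prob t =
        (\<Sum>b\<in>set_mset B. real (count B b) * real (num_vertices b)) * (W / F)"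
      unfolding t tree_prob_Node[OF False] sum_distrib_right by (intro sum.cong) auto
    also have "(\<Sum>b\<in>set_mset B. real (count B b) * real (num_vertices b)) = real (num_vertices t - 1)"
      unfolding t sum_mset_eq_sum_count[symmetric] by simp
    finally have "real (num_vertices t - 1) * tree_prob t = real (num_vertices t - 1) * (W / F)" .
    moreover have "num_vertices t - 1 > 0"
    proof -
      obtain b where "b \<in># B" using False by auto
      then show ?thesis using num_vertices_pos[of b] by (auto simp: t dest!: multi_member_split)
    qed
    ultimately have "tree_prob t = W / F" by (simp only: mult_cancel_left) auto
    then show ?thesis
      unfolding t exp_tree_sum_toll_Node F_def W_def
      using num_vertices_pos[of "Node B"] by (simp del: num_vertices.simps)
  qed
qed

section \<open>Exponential bounds from counting unordered trees\<close>

text \<open>Every tree except \<open>leaf\<close> is some \<open>add_branch s r\<close>, so the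
  partial generating functions satisfy \<open>P (N + 1) \<le> x + (P N)^2\<close>; at
  \<open>x = 1/4\<close> the bound 1/2 reproduces itself.\<close>

lemma sum_polya_le: "(\<Sum>t\<in>{t. num_vertices t \<le> N}. (1 / 4) ^ num_vertices t) \<le> (1 / 2 :: real)"
proof (induction N)
  case 0
  have "{t. num_vertices t \<le> 0} = {}"
    using num_vertices_pos by (metis Collect_empty_eq le_zero_eq not_one_le_zero)
  then show ?case by (simp only: sum.empty)
next
  case (Suc N)
  let ?S = "{t. num_vertices t \<le> N}" and ?w = "\<lambda>t. (1 / 4 :: real) ^ num_vertices t"
  let ?f = "\<lambda>(s, r). add_branch s r"
  have fin: "finite (?S \<times> ?S)" by (intro finite_cartesian_product finite_utrees_le)
  have sub: "{t. num_vertices t \<le> Suc N} \<subseteq> {leaf} \<union> ?f ` (?S \<times> ?S)"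
  proof
    fix t assume t: "t \<in> {t. num_vertices t \<le> Suc N}"
    obtain B where B: "t = Node B" by (cases t)
    show "t \<in> {leaf} \<union> ?f ` (?S \<times> ?S)"
    proof (cases "B = {#}")
      case False
      then obtain b where b: "b \<in># B" by auto
      then have "t = ?f (b, Node (B - {#b#}))" by (simp add: B add_branch_def)
      moreover have "num_vertices b + num_vertices (Node (B - {#b#})) \<le> Suc N"
        using t b by (auto simp: B dest!: multi_member_split)
      then have "(b, Node (B - {#b#})) \<in> ?S \<times> ?S"
        using num_vertices_pos[of b] num_vertices_pos[of "Node (B - {#b#})"]
        by (simp del: num_vertices.simps)
      ultimately show ?thesis by blast
    qed (simp add: B leaf_def)
  qed
  have "(\<Sum>t\<in>{t. num_vertices t \<le> Suc N}. ?w t) \<le> (\<Sum>t\<in>{leaf} \<union> ?f ` (?S \<times> ?S). ?w t)"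
    using fin by (intro sum_mono2 sub) auto
  also have "\<dots> \<le> (\<Sum>t\<in>{leaf}. ?w t) + (\<Sum>t\<in>?f ` (?S \<times> ?S). ?w t)"
    using fin sum_nonneg[of "{leaf} \<inter> ?f ` (?S \<times> ?S)" ?w] by (subst sum_Un) auto
  also have "(\<Sum>t\<in>?f ` (?S \<times> ?S). ?w t) \<le> (\<Sum>x\<in>?S \<times> ?S. ?w (?f x))"
    using sum_image_le[OF fin, of ?w ?f] by (simp add: comp_def)
  also have "\<dots> = (\<Sum>t\<in>?S. ?w t) * (\<Sum>t\<in>?S. ?w t)"
    by (simp add: sum_product sum.cartesian_product num_vertices_add_branch power_add case_prod_unfold)
  also have "\<dots> \<le> 1 / 2 * (1 / 2)"
    by (intro mult_mono Suc.IH sum_nonneg) auto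
  finally show ?case by simp
qed

lemma polya_count_le: "real (polya_count k) \<le> 4 ^ k / 2"
proof -
  have "(\<Sum>t\<in>{t. num_vertices t = k}. (1 / 4 :: real) ^ num_vertices t) \<le>
      (\<Sum>t\<in>{t. num_vertices t \<le> k}. (1 / 4) ^ num_vertices t)"
    by (intro sum_mono2 finite_utrees_le) auto
  also note sum_polya_le
  finally show ?thesis by (simp add: polya_count_def field_simps)
qed

lemma toll_ge_ln: "toll t \<ge> ln (real (num_vertices t))"
proof -
  have "(1::real) \<le> (\<Prod>b\<in>set_mset (branches t). fact (count (branches t) b))"
    by (rule prod_ge_1) (metis fact_ge_1)
  then show ?thesis by (simp add: toll_def)
qed

lemma toll_nonneg: "0 \<le> toll t"
  using toll_ge_ln[of t] num_vertices_pos[of t] by (smt (verit) ln_ge_zero of_nat_1 of_nat_mono)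

text \<open>
  This is the bound of the entropy of a random recursive tree by the logarithm of the number
  of trees, since \<open>tree_sum toll t\<close> is \<open>- ln (tree_prob t)\<close> up to \<open>ln n\<close>.
\<close>

lemma rrt_mean_tree_sum_toll_le:
  assumes "n \<ge> 1"
  shows "rrt_mean n (tree_sum toll) \<le> (ln 4 + 1 / 2) * real n"
proof -
  have "tree_sum toll t \<le> exp (tree_sum toll t) / 4 ^ n + real n * ln 4" for t
  proof -
    have "1 + (tree_sum toll t - real n * ln 4) \<le> exp (tree_sum toll t - real n * ln 4)"
      by (rule exp_ge_add_one_self)
    also have "\<dots> = exp (tree_sum toll t) / 4 ^ n"
      by (simp add: exp_diff exp_of_nat_mult)
    finally show ?thesis by simp
  qed
  then have "rrt_mean n (tree_sum toll) \<le> rrt_mean n (\<lambda>t. exp (tree_sum toll t) / 4 ^ n + real n * ln 4)"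
    by (intro rrt_mean_mono assms)
  also have "\<dots> = rrt_mean n (\<lambda>t. exp (tree_sum toll t) / 4 ^ n) + real n * ln 4"
    by (simp add: rrt_mean_add rrt_mean_const)
  \<comment> \<open>By \<open>tree_prob_eq\<close>,
    \<open>tree_prob t * exp (tree_sum toll t)\<close> is just \<open>n\<close>, so this mean counts
    the trees.\<close>
  also have "rrt_mean n (\<lambda>t. exp (tree_sum toll t) / 4 ^ n) = (\<Sum>t\<in>{t. num_vertices t = n}. real n / 4 ^ n)"
    unfolding rrt_mean_eq_sum[OF assms] by (rule sum.cong) (auto simp: tree_prob_eq exp_minus)
  also have "\<dots> = real n * (real (polya_count n) / 4 ^ n)"
    by (simp add: polya_count_def)
  also have "\<dots> \<le> real n * (1 / 2)"
    using polya_count_le[of n] by (intro mult_left_mono) (auto simp: field_simps)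
  finally show ?thesis by (simp add: algebra_simps)
qed

lemma rrt_mean_toll_nonneg: "0 \<le> rrt_mean (Suc k) toll"
  by (rule rrt_mean_nonneg) (simp_all add: toll_nonneg)

text \<open>The toll is unbounded, so the bounded case does not apply; the linear bound for the mean
  of \<open>tree_sum toll\<close> limits every partial sum instead.\<close>

lemma summable_toll:
  "summable (\<lambda>k. rrt_mean (Suc k) toll / (real (Suc k) * real (Suc k + 1)))"
proof (rule summableI_nonneg_bounded)
  fix n
  let ?P = "\<Sum>k<n. rrt_mean (Suc k) toll / (real (Suc k) * real (Suc k + 1))"
  have "real (Suc n) * ?P \<le> rrt_mean (Suc n) (tree_sum toll)"
    unfolding rrt_mean_tree_sum using rrt_mean_toll_nonneg[of n] by simp
  also have "\<dots> \<le> real (Suc n) * (ln 4 + 1 / 2)"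
    using rrt_mean_tree_sum_toll_le[of "Suc n"] by (simp add: mult.commute)
  finally show "?P \<le> ln 4 + 1 / 2" by (rule mult_left_le_imp_le) simp
qed (simp add: rrt_mean_toll_nonneg)

lemma c17_pos: "c17 > 0"
  unfolding c17_eq fringe_density_def
proof (rule suminf_pos2[OF summable_toll])
  have "rrt_mean 2 (\<lambda>_. ln 2) \<le> rrt_mean 2 toll"
  proof (rule rrt_mean_mono)
    fix t assume "num_vertices t = 2"
    then show "ln 2 \<le> toll t" using toll_ge_ln[of t] by simp
  qed simp
  then show "0 < rrt_mean (Suc 1) toll / (real (Suc 1) * real (Suc 1 + 1))"
    by (simp add: rrt_mean_const numeral_2_eq_2[symmetric]) (smt (verit) ln_gt_zero)
qed (simp add: rrt_mean_toll_nonneg)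

subsection \<open>Coinciding pairs and typical shapes\<close>

text \<open>Only the term of size \<open>num_vertices t0\<close> is nonzero. Its weight is crudely
  replaced by 1, which also covers the case that \<open>t0\<close> is the whole tree.\<close>

lemma rrt_mean_count_le:
  assumes "n \<ge> 1"
  shows "rrt_mean n (\<lambda>t. real (count (fringes t) t0)) \<le> real n * tree_prob t0"
proof -
  obtain m where m: "n = Suc m" using assms by (cases n) auto
  define \<gamma> where "\<gamma> k = rrt_mean k (\<lambda>x. of_bool (x = t0))" for k
  have \<gamma>: "\<gamma> (Suc k) = (if k = num_vertices t0 - 1 then tree_prob t0 else 0)" for k
    using num_vertices_pos[of t0] by (auto simp: \<gamma>_def rrt_mean_of_bool_eq)
  have nonneg: "0 \<le> \<gamma> (Suc k)" for k using tree_prob_nonneg by (simp add: \<gamma>)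
  have "rrt_mean n (\<lambda>t. real (count (fringes t) t0)) =
      real n * (\<Sum>k<m. \<gamma> (Suc k) / (real (Suc k) * real (Suc k + 1))) + \<gamma> (Suc m)"
    using rrt_mean_tree_sum[of m "\<lambda>x. of_bool (x = t0)"]
    by (simp add: tree_sum_of_bool_eq[abs_def] m \<gamma>_def)
  also have "\<dots> \<le> real n * (\<Sum>k<m. \<gamma> (Suc k)) + real n * \<gamma> (Suc m)"
  proof (intro add_mono mult_left_mono sum_mono)
    fix k
    have "1 * 1 \<le> real (Suc k) * real (Suc k + 1)" by (intro mult_mono) auto
    then show "\<gamma> (Suc k) / (real (Suc k) * real (Suc k + 1)) \<le> \<gamma> (Suc k)"
      using nonneg[of k] mult_left_mono[of 1 "real (Suc k) * real (Suc k + 1)" "\<gamma> (Suc k)"]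
      by (subst divide_le_eq) (simp del: of_nat_Suc)
    show "\<gamma> (Suc m) \<le> real n * \<gamma> (Suc m)"
      using nonneg[of m] mult_right_mono[of 1 "real n" "\<gamma> (Suc m)"] by (simp add: m)
  qed auto
  also have "\<dots> = real n * (\<Sum>k<Suc m. \<gamma> (Suc k))" by (simp add: distrib_left)
  also have "\<dots> \<le> real n * tree_prob t0"
    unfolding \<gamma> using tree_prob_nonneg by (intro mult_left_mono) (simp_all add: sum.delta)
  finally show ?thesis .
qed

text \<open>Counts ordered pairs of distinct vertices of shape \<open>t0\<close>. Pairs separated by
  the split are independent, and the bound reproduces itself because
  \<open>2 l^2 + 2 l (n - l) = 2 l n\<close> has mean \<open>n^2\<close> over \<open>l\<close> in
  \<open>{1..n-1}\<close>.\<close>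

lemma rrt_mean_pairs_le:
  assumes "n \<ge> 1"
  shows "rrt_mean n (\<lambda>t. real (count (fringes t) t0) * (real (count (fringes t) t0) - 1))
           \<le> (tree_prob t0 * real n)\<^sup>2"
  using assms
proof (induction n rule: less_induct)
  case (less n)
  define X where "X t = real (count (fringes t) t0)" for t
  show ?case
  proof (cases "n = 1")
    case True
    have "X leaf * (X leaf - 1) = 0" by (simp add: X_def leaf_def)
    then have "rrt_mean n (\<lambda>t. X t * (X t - 1)) = 0"
      using True by (simp only: rrt_mean_one)
    then show ?thesis by (simp add: X_def)
  next
    case False
    then have n: "n \<ge> 2" using less.prems by simp
    have step: "X (add_branch s r) * (X (add_branch s r) - 1) \<le>
        X s * (X s - 1) + X r * (X r - 1) + 2 * (X s * X r) + 0" for s r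
    \<comment> \<open>If the whole tree has shape \<open>t0\<close>, then \<open>t0\<close> is too
      large to occur elsewhere and there is no pair; otherwise joining creates no new
      occurrence.\<close>
    proof (cases "t0 = add_branch s r")
      case True
      have "num_vertices s < num_vertices t0" "num_vertices r < num_vertices t0"
        using num_vertices_pos[of s] num_vertices_pos[of r] by (simp_all add: True num_vertices_add_branch)
      then have "t0 \<notin># fringes s" "t0 \<notin># fringes r" "r \<noteq> t0"
        using num_vertices_fringes_le[of t0 s] num_vertices_fringes_le[of t0 r] by auto
      then have "count (fringes s) t0 = 0" "count (fringes r) t0 = 0" "r \<noteq> t0"
        by (simp_all add: not_in_iff)
      moreover from this have "count (fringes (add_branch s r)) t0 = 1"
        using arg_cong[OF fringes_add_branch[of r s], of "\<lambda>M. count M t0"] True by simp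
      ultimately show ?thesis by (simp add: X_def)
    next
      case False
      define N M where "N = count (fringes (add_branch s r)) t0"
        and "M = count (fringes s) t0 + count (fringes r) t0"
      have "N \<le> M"
        using arg_cong[OF fringes_add_branch[of r s], of "\<lambda>M. count M t0"] False
        by (auto simp: N_def M_def split: if_splits)
      have "real N * (real N - 1) \<le> real M * (real M - 1)"
      proof (cases "N = 0")
        case True
        then show ?thesis by (cases "M = 0") auto
      qed (use \<open>N \<le> M\<close> in \<open>auto intro!: mult_mono\<close>)
      also have "\<dots> = X s * (X s - 1) + X r * (X r - 1) + 2 * (X s * X r) + 0"
        by (simp add: M_def X_def algebra_simps)
      finally show ?thesis by (simp only: X_def N_def)
    qed
    have "rrt_mean n (\<lambda>t. X t * (X t - 1)) \<le> (\<Sum>l=1..n-1. 2 * rrt_mean l (\<lambda>t. X t * (X t - 1)) +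
        2 * (rrt_mean l X * rrt_mean (n - l) X)) / real (n - 1) + 0"
      by (rule rrt_mean_split_le[OF n, where a = "\<lambda>t. X t * (X t - 1)" and b = X]) (rule step)
    also have "\<dots> \<le> (\<Sum>l=1..n-1. 2 * (tree_prob t0 * real l)\<^sup>2 +
        2 * ((real l * tree_prob t0) * (real (n - l) * tree_prob t0))) / real (n - 1) + 0"
    proof (intro add_mono divide_right_mono sum_mono mult_left_mono mult_mono)
      fix l assume l: "l \<in> {1..n-1}"
      show "rrt_mean l (\<lambda>t. X t * (X t - 1)) \<le> (tree_prob t0 * real l)\<^sup>2"
        unfolding X_def by (rule less.IH) (use l in auto)
      show "rrt_mean l X \<le> real l * tree_prob t0" "rrt_mean (n - l) X \<le> real (n - l) * tree_prob t0"
        unfolding X_def[abs_def] using l by (auto intro!: rrt_mean_count_le simp del: of_nat_diff)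
      show "0 \<le> rrt_mean (n - l) X" using l by (intro rrt_mean_nonneg) (auto simp: X_def)
    qed (auto simp: tree_prob_nonneg)
    also have "(\<Sum>l=1..n-1. 2 * (tree_prob t0 * real l)\<^sup>2 +
        2 * ((real l * tree_prob t0) * (real (n - l) * tree_prob t0))) =
        (\<Sum>l=1..n-1. 2 * (tree_prob t0)\<^sup>2 * real n * real l)"
      by (rule sum.cong) (auto simp: of_nat_diff power2_eq_square algebra_simps)
    also have "\<dots> = 2 * (tree_prob t0)\<^sup>2 * real n * (\<Sum>l=1..n-1. real l)"
      by (rule sum_distrib_left[symmetric])
    also have "(\<Sum>l=1..n-1. real l) = real (n - 1) * real n / 2"
    proof -
      have "(\<Sum>l=1..m. real l) = real m * real (Suc m) / 2" for m
        by (induction m) (simp_all add: field_simps)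
      from this[of "n - 1"] show ?thesis using n by simp
    qed
    finally show ?thesis
      using n by (simp add: X_def power2_eq_square mult_ac)
  qed
qed

text \<open>Only the lower tail is wanted, so the toll may be replaced by a smaller, bounded one, to
  which the variance bound applies.\<close>

lemma tree_sum_toll_deviation:
  assumes "a < c17"
  shows "(\<lambda>n. rrt_mean n (\<lambda>t. of_bool (tree_sum toll t < a * real (num_vertices t)))) \<longlonglongrightarrow> 0"
proof -
  define \<tau> where "\<tau> k = rrt_mean (Suc k) toll / (real (Suc k) * real (Suc k + 1))" for k
  have "(\<lambda>M. \<Sum>k<M. \<tau> k) \<longlonglongrightarrow> c17"
    unfolding c17_eq fringe_density_def \<tau>_def[abs_def] by (rule summable_LIMSEQ[OF summable_toll])
  from order_tendstoD(1)[OF this assms] obtain M where M: "a < (\<Sum>k<M. \<tau> k)"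
    by (auto simp: eventually_sequentially)
  define g where "g t = of_bool (num_vertices t \<le> M) * toll t" for t
  \<comment> \<open>Any bound on the finitely many tolls that survive the truncation serves; their
    sum is one.\<close>
  define C where "C = (\<Sum>t\<in>{t. num_vertices t \<le> M}. toll t)"
  have C: "0 \<le> C" unfolding C_def by (rule sum_nonneg) (rule toll_nonneg)
  have g: "0 \<le> g t" "g t \<le> C" for t
  proof -
    show "0 \<le> g t" by (simp add: g_def toll_nonneg)
    show "g t \<le> C"
    proof (cases "num_vertices t \<le> M")
      case True
      then show ?thesis
        using member_le_sum[of t "{t. num_vertices t \<le> M}" toll]
        by (simp add: g_def C_def toll_nonneg finite_utrees_le)
    qed (simp add: g_def C)
  qed
  define d where "d = fringe_density g"
  have "(\<Sum>k<M. \<tau> k) = (\<Sum>k<M. rrt_mean (Suc k) g / (real (Suc k) * real (Suc k + 1)))"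
  proof (rule sum.cong[OF refl])
    fix k assume "k \<in> {..<M}"
    then have "rrt_mean (Suc k) toll = rrt_mean (Suc k) g"
      by (intro rrt_mean_cong) (auto simp: g_def)
    then show "\<tau> k = rrt_mean (Suc k) g / (real (Suc k) * real (Suc k + 1))"
      by (simp add: \<tau>_def)
  qed
  also have "\<dots> \<le> d"
    unfolding d_def fringe_density_def
    using density_term_bounds(1)[OF g] by (intro sum_le_suminf summable_fringe_density[OF g]) auto
  finally have ad: "a < d" using M by simp
  have le: "tree_sum g t \<le> tree_sum toll t" for t
    by (rule tree_sum_mono) (simp add: g_def toll_nonneg)
  have "rrt_mean n (\<lambda>t. of_bool (tree_sum toll t < a * real (num_vertices t))) \<le>
      140 * C\<^sup>2 * (real n * sqrt (real n)) * (1 / ((d - a) * real n)\<^sup>2)" if n: "n \<ge> 1" for n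
  proof -
    have "rrt_mean n (\<lambda>t. of_bool (tree_sum toll t < a * real (num_vertices t))) \<le>
        rrt_mean n (\<lambda>t. (tree_sum g t - d * real (num_vertices t))\<^sup>2 * (1 / ((d - a) * real n)\<^sup>2))"
    proof (rule rrt_mean_mono[OF n])
      fix t assume t: "num_vertices t = n"
      show "of_bool (tree_sum toll t < a * real (num_vertices t)) \<le>
          (tree_sum g t - d * real (num_vertices t))\<^sup>2 * (1 / ((d - a) * real n)\<^sup>2)"
      proof (cases "tree_sum toll t < a * real n")
        case True
        then have "(d - a) * real n \<le> d * real n - tree_sum g t"
          using le[of t] by (simp add: algebra_simps)
        then have "((d - a) * real n)\<^sup>2 \<le> (d * real n - tree_sum g t)\<^sup>2"
          using ad by (intro power_mono) auto
        then show ?thesis using True ad n t by (simp add: power2_commute divide_simps)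
      qed (simp add: t)
    qed
    also have "\<dots> = rrt_mean n (\<lambda>t. (tree_sum g t - d * real (num_vertices t))\<^sup>2) * (1 / ((d - a) * real n)\<^sup>2)"
      by (rule rrt_mean_cmult_right)
    also have "\<dots> \<le> 140 * C\<^sup>2 * (real n * sqrt (real n)) * (1 / ((d - a) * real n)\<^sup>2)"
      unfolding d_def by (intro mult_right_mono rrt_mean_tree_sum_deviation g n) auto
    finally show ?thesis .
  qed
  then have up: "\<forall>\<^sub>F n in sequentially. rrt_mean n (\<lambda>t. of_bool (tree_sum toll t < a * real (num_vertices t))) \<le>
      140 * C\<^sup>2 * (real n * sqrt (real n)) * (1 / ((d - a) * real n)\<^sup>2)"
    by (rule eventually_sequentiallyI)
  have low: "\<forall>\<^sub>F n in sequentially. 0 \<le> rrt_mean n (\<lambda>t. of_bool (tree_sum toll t < a * real (num_vertices t)))"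
    by (rule eventually_sequentiallyI[of 1]) (rule rrt_mean_nonneg, auto)
  have "(\<lambda>n. real n * sqrt (real n) * (1 / (real n)\<^sup>2)) \<longlonglongrightarrow> 0" by real_asymp
  from tendsto_mult_right_zero[OF this, of "140 * C\<^sup>2 / (d - a)\<^sup>2"]
  have "(\<lambda>n. 140 * C\<^sup>2 * (real n * sqrt (real n)) * (1 / ((d - a) * real n)\<^sup>2)) \<longlonglongrightarrow> 0"
    by (simp add: power_mult_distrib)
  from tendsto_sandwich[OF low up tendsto_const this] show ?thesis .
qed

subsection \<open>The growth constant of Polya trees\<close>

text \<open>Fekete's lemma for sequences that are superadditive from \<open>k0\<close> on; the limit
  is the supremum of the quotients from there on.\<close>

lemma superadditive_quotient_tendsto:
  fixes w :: "nat \<Rightarrow> real"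
  assumes super: "\<And>m n. m \<ge> k0 \<Longrightarrow> n \<ge> k0 \<Longrightarrow> w m + w n \<le> w (m + n)"
    and bound: "\<And>n. n \<ge> k0 \<Longrightarrow> w n \<le> C * real n" and k0: "k0 > 0"
  obtains l where "(\<lambda>n. w n / real n) \<longlonglongrightarrow> l" "\<And>n. n \<ge> k0 \<Longrightarrow> w n / real n \<le> l"
proof
  define l where "l = (SUP n\<in>{k0..}. w n / real n)"
  have bdd: "bdd_above ((\<lambda>n. w n / real n) ` {k0..})"
    using bound k0 by (intro bdd_aboveI[of _ C]) (auto simp: divide_le_eq)
  show upper: "w n / real n \<le> l" if "n \<ge> k0" for n
    unfolding l_def using that by (intro cSUP_upper bdd) auto
  show "(\<lambda>n. w n / real n) \<longlonglongrightarrow> l"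
  proof (rule order_tendstoI)
    fix u assume "l < u"
    then show "\<forall>\<^sub>F n in sequentially. w n / real n < u"
      using upper by (intro eventually_sequentiallyI[of k0]) (meson le_less_trans)
  next
    fix u assume "u < l"
    then obtain n where n: "n \<ge> k0" "u < w n / real n"
      unfolding l_def by (subst (asm) less_cSUP_iff[OF _ bdd]) auto
    define D where "D = Min (w ` {n..<2 * n})"
    have npos: "n > 0" using n k0 by linarith
    have multiples: "real q * w n + w r \<le> w (q * n + r)" if "r \<ge> k0" for q r
    proof (induction q)
      case (Suc q)
      have "w n + w (q * n + r) \<le> w (n + (q * n + r))" using n that by (intro super) auto
      then show ?case using Suc by (simp add: algebra_simps)
    qed simp
    have lower: "w N / real N \<ge> w n / real n - (2 * \<bar>w n\<bar> + \<bar>D\<bar>) / real N" if N: "N \<ge> n" for N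
    proof -
      \<comment> \<open>One multiple of \<open>n\<close> is moved into the remainder, so that
        \<open>r\<close> is at least \<open>n\<close>, hence at least \<open>k0\<close>, and
        superadditivity applies to it.\<close>
      define q r where "q = N div n - 1" and "r = N mod n + n"
      have "N div n = Suc q" using N npos by (simp add: q_def div_greater_zero_iff)
      then have "N = q * n + r"
        using div_mult_mod_eq[of N n] by (simp add: r_def)
      have r: "r \<in> {n..<2 * n}" using npos by (simp add: r_def)
      have Npos: "real N > 0" using N npos by simp
      have "D \<le> w r" unfolding D_def using r by (intro Min_le) auto
      then have "real q * w n + D \<le> w N"
        using multiples[of r q] r n \<open>N = q * n + r\<close> by simp
      moreover have "real q * w n = real N * (w n / real n) - (real r / real n) * w n"
        using npos \<open>N = q * n + r\<close> by (simp add: field_simps)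
      moreover have "(real r / real n) * w n \<le> 2 * \<bar>w n\<bar>"
        using r npos by (intro order_trans[OF mult_left_mono[OF abs_ge_self] mult_right_mono])
          (auto simp: divide_le_eq)
      ultimately have "w N \<ge> real N * (w n / real n) - (2 * \<bar>w n\<bar> + \<bar>D\<bar>)"
        by linarith
      then have "w N / real N \<ge> (real N * (w n / real n) - (2 * \<bar>w n\<bar> + \<bar>D\<bar>)) / real N"
        using Npos by (intro divide_right_mono) auto
      then show ?thesis using Npos by (simp add: diff_divide_distrib)
    qed
    have "(\<lambda>N. w n / real n - (2 * \<bar>w n\<bar> + \<bar>D\<bar>) / real N) \<longlonglongrightarrow> w n / real n - 0"
      by (intro tendsto_intros lim_const_over_n)
    then have "\<forall>\<^sub>F N in sequentially. u < w n / real n - (2 * \<bar>w n\<bar> + \<bar>D\<bar>) / real N"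
      using n(2) by (intro order_tendstoD(1)) auto
    with eventually_ge_at_top[of n] show "\<forall>\<^sub>F N in sequentially. u < w N / real N"
      by eventually_elim (use lower in force)
  qed
qed

lemma polya_count_pos:
  assumes "k \<ge> 1"
  shows "polya_count k > 0"
proof -
  have "\<exists>t. num_vertices t = k"
    using assms
  proof (induction k rule: nat_induct_at_least)
    case base
    show ?case using num_vertices_leaf by blast
  next
    case (Suc k)
    then obtain t where "num_vertices t = k" by blast
    then have "num_vertices (Node {#t#}) = Suc k" by simp
    then show ?case by blast
  qed
  then show ?thesis by (auto simp: polya_count_def card_gt_0_iff finite_utrees)
qed

text \<open>Two trees are hung below a new root; an unordered pair comes from at most two ordered
  ones.\<close>

lemma polya_count_super: "polya_count m * polya_count n \<le> 2 * polya_count (m + n + 1)"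
proof -
  let ?f = "\<lambda>(s, t). Node {#s, t#}"
  let ?A = "{t. num_vertices t = m} \<times> {t. num_vertices t = n}"
  have fin: "finite ?A" by (intro finite_cartesian_product finite_utrees)
  have "card (?f -` {x} \<inter> ?A) \<le> 2" if x: "x \<in> ?f ` ?A" for x
  proof -
    obtain s t where x: "x = ?f (s, t)" using x by auto
    have "?f -` {x} \<inter> ?A \<subseteq> {(s, t), (t, s)}" 
    proof
      fix y assume "y \<in> ?f -` {x} \<inter> ?A"
      then obtain a b where y: "y = (a, b)" "{#a, b#} = {#s, t#}" by (auto simp: x)
      then have "a \<in># {#s, t#}" by (metis union_single_eq_member)
      then show "y \<in> {(s, t), (t, s)}" using y by (auto simp: add_mset_commute[of t s])
    qed
    then have "card (?f -` {x} \<inter> ?A) \<le> card {(s, t), (t, s)}" by (rule card_mono[rotated]) simp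
    also have "card {u, v} \<le> 2" for u v :: "utree \<times> utree" by (cases "u = v") auto
    finally show ?thesis .
  qed
  then have "(\<Sum>x\<in>?f ` ?A. card (?f -` {x} \<inter> ?A)) \<le> (\<Sum>x\<in>?f ` ?A. 2)" by (rule sum_mono)
  moreover have "card ?A \<le> (\<Sum>x\<in>?f ` ?A. card (?f -` {x} \<inter> ?A))"
  proof -
    have "?A = (\<Union>x\<in>?f ` ?A. ?f -` {x} \<inter> ?A)" by auto
    then show ?thesis using card_UN_le[of "?f ` ?A" "\<lambda>x. ?f -` {x} \<inter> ?A"] fin by simp
  qed
  moreover have "card (?f ` ?A) \<le> polya_count (m + n + 1)"
    unfolding polya_count_def by (intro card_mono finite_utrees) auto
  ultimately show ?thesis by (simp add: polya_count_def card_cartesian_product)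
qed

text \<open>Three trees told apart by their root degrees. More than two are needed to make
  \<open>ln (polya_count 4 / 2)\<close> positive, which yields \<open>c18 > 0\<close>.\<close>

lemma polya_count_4: "polya_count 4 \<ge> 3"
proof -
  let ?A = "{Node {#leaf, leaf, leaf#}, Node {#leaf, Node {#leaf#}#}, Node {#Node {#leaf, leaf#}#}}"
  have "(\<lambda>t. size (branches t)) ` ?A = {3, 2, 1}" by auto
  then have "3 \<le> card ?A" using card_image_le[of ?A "\<lambda>t. size (branches t)"] by simp
  also have "card ?A \<le> polya_count 4"
    unfolding polya_count_def by (intro card_mono finite_utrees) auto
  finally show ?thesis .
qed

text \<open>\<open>polya_growth\<close> is defined by \<open>lim\<close>, which says nothing until
  convergence is known; Fekete's lemma supplies it.\<close>

lemma c18_tendsto: "(\<lambda>k. ln (real (polya_count k)) / real k) \<longlonglongrightarrow> c18" and c18_pos: "c18 > 0"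
proof -
  \<comment> \<open>The shift absorbs the extra root in \<open>polya_count_super\<close> and the
    halving its factor 2, which makes \<open>w\<close> superadditive.\<close>
  define w where "w n = ln (real (polya_count (n - 1)) / 2)" for n
  obtain l where l: "(\<lambda>n. w n / real n) \<longlonglongrightarrow> l" "\<And>n. n \<ge> 2 \<Longrightarrow> w n / real n \<le> l"
  proof (rule superadditive_quotient_tendsto[of 2 w "ln 4"])
    fix m n :: nat assume mn: "2 \<le> m" "2 \<le> n"
    then have pos: "polya_count (m - 1) > 0" "polya_count (n - 1) > 0" by (auto intro: polya_count_pos)
    have "m - 1 + (n - 1) + 1 = m + n - 1" using mn by simp
    then have "polya_count (m - 1) * polya_count (n - 1) \<le> 2 * polya_count (m + n - 1)"
      using polya_count_super[of "m - 1" "n - 1"] by (simp only:)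
    then have "real (polya_count (m - 1)) * real (polya_count (n - 1)) \<le> 2 * real (polya_count (m + n - 1))"
      by (metis of_nat_le_iff of_nat_mult of_nat_numeral)
    then have "(real (polya_count (m - 1)) / 2) * (real (polya_count (n - 1)) / 2) \<le>
        real (polya_count (m + n - 1)) / 2"
      by simp
    then have "ln ((real (polya_count (m - 1)) / 2) * (real (polya_count (n - 1)) / 2)) \<le>
        ln (real (polya_count (m + n - 1)) / 2)"
      using pos by (intro ln_mono) auto
    then show "w m + w n \<le> w (m + n)"
      unfolding w_def using pos by (subst ln_mult_pos[symmetric]) auto
  next
    fix n :: nat assume "n \<ge> 2"
    then have pos: "polya_count (n - 1) > 0" by (auto intro: polya_count_pos)
    have "(4::real) ^ (n - 1) \<le> 4 ^ n" "(0::real) \<le> 4 ^ n" by (auto intro: power_increasing)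
    with polya_count_le[of "n - 1"] have "real (polya_count (n - 1)) / 2 \<le> 4 ^ n" by linarith
    with pos have "w n \<le> ln (4 ^ n)" unfolding w_def by (subst ln_le_cancel_iff) auto
    then show "w n \<le> ln 4 * real n" by (simp add: ln_realpow mult.commute)
  qed (use that in auto)
  have lim: "(\<lambda>k. ln (real (polya_count k)) / real k) \<longlonglongrightarrow> l"
  proof (rule Lim_transform_eventually)
    have "(\<lambda>k. real (Suc k) / real k) \<longlonglongrightarrow> 1" "(\<lambda>k. ln 2 / real k) \<longlonglongrightarrow> 0"
      by real_asymp+
    from tendsto_add[OF tendsto_mult[OF LIMSEQ_Suc[OF l(1)] this(1)] this(2)]
    show "(\<lambda>k. w (Suc k) / real (Suc k) * (real (Suc k) / real k) + ln 2 / real k) \<longlonglongrightarrow> l"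
      by simp
    show "\<forall>\<^sub>F k in sequentially. w (Suc k) / real (Suc k) * (real (Suc k) / real k) + ln 2 / real k =
        ln (real (polya_count k)) / real k"
      using eventually_ge_at_top[of 1]
    proof eventually_elim
      case (elim k)
      then have "w (Suc k) = ln (real (polya_count k)) - ln 2"
        using polya_count_pos[of k] by (simp add: w_def ln_div)
      then show ?case by (simp add: add_divide_distrib[symmetric] del: of_nat_Suc)
    qed
  qed
  have "(\<lambda>k. root k (real (polya_count k))) \<longlonglongrightarrow> exp l"
  proof (rule Lim_transform_eventually)
    show "(\<lambda>k. exp (ln (real (polya_count k)) / real k)) \<longlonglongrightarrow> exp l"
      by (intro tendsto_intros lim)
    show "\<forall>\<^sub>F k in sequentially. exp (ln (real (polya_count k)) / real k) = root k (real (polya_count k))"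
      using eventually_ge_at_top[of 1]
      by eventually_elim (use polya_count_pos in \<open>auto simp: root_powr_inverse powr_def\<close>)
  qed
  then have c18: "c18 = l" by (simp add: c18_def polya_growth_def limI)
  show "(\<lambda>k. ln (real (polya_count k)) / real k) \<longlonglongrightarrow> c18" using lim c18 by simp
  \<comment> \<open>The limit dominates every quotient, so a single positive one suffices.\<close>
  have "0 < w 5 / real 5" using polya_count_4 by (simp add: w_def)
  then show "c18 > 0" using l(2)[of 5] c18 by simp
qed

subsection \<open>The number of distinct fringe subtrees\<close>

lemma card_set_mset_le_size: "card (set_mset M) \<le> size M"
proof -
  have "card (set_mset M) = (\<Sum>x\<in>set_mset M. 1)" by simp
  also have "\<dots> \<le> (\<Sum>x\<in>set_mset M. count M x)" by (intro sum_mono) (simp add: Suc_le_eq)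
  also have "\<dots> = size M" by (simp add: size_multiset_overloaded_eq)
  finally show ?thesis .
qed

text \<open>Small shapes are bounded by the number of all small trees, large ones by their
  occurrences.\<close>

lemma num_distinct_le:
  "real (num_distinct t) \<le> real (card {x. num_vertices x < k}) + tree_sum (\<lambda>x. of_bool (k \<le> num_vertices x)) t"
proof -
  let ?S = "{x. num_vertices x < k}" and ?L = "{#x \<in># fringes t. x \<in> {x. k \<le> num_vertices x}#}"
  have fin: "finite ?S" by (rule finite_subset[OF _ finite_utrees_le[of k]]) auto
  have "num_distinct t \<le> card (?S \<union> set_mset ?L)"
    unfolding num_distinct_def using fin by (intro card_mono) auto
  also have "\<dots> \<le> card ?S + card (set_mset ?L)" by (rule card_Un_le)
  also have "card (set_mset ?L) \<le> size ?L" by (rule card_set_mset_le_size)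
  finally have "real (num_distinct t) \<le> real (card ?S) + real (size ?L)" by simp
  also have "real (size ?L) = tree_sum (\<lambda>x. of_bool (k \<le> num_vertices x)) t"
    using tree_sum_of_bool_mem[of "{x. k \<le> num_vertices x}" t] by simp
  finally show ?thesis .
qed

text \<open>Since \<open>c \<le> 1 + c * (c - 1)\<close>, occurrences exceed distinct shapes by at
  most the number of ordered coinciding pairs. The finite set \<open>A\<close> makes the sum
  independent of \<open>t\<close>.\<close>

lemma num_distinct_ge:
  assumes "finite A" "\<And>x. x \<in># fringes t \<Longrightarrow> x \<in> H \<Longrightarrow> x \<in> A"
  shows "tree_sum (\<lambda>x. of_bool (x \<in> H)) t \<le> real (num_distinct t) +
    (\<Sum>x\<in>A. real (count (fringes t) x) * (real (count (fringes t) x) - 1))"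
proof -
  let ?F = "fringes t"
  let ?D = "set_mset {#x \<in># ?F. x \<in> H#}"
  have pair: "0 \<le> real c * (real c - 1)" "real c \<le> 1 + real c * (real c - 1)" for c :: nat
  proof -
    show "0 \<le> real c * (real c - 1)" by (cases c) auto
    show "real c \<le> 1 + real c * (real c - 1)"
      using zero_le_power2[of "real c - 1"] by (simp add: power2_eq_square algebra_simps)
  qed
  have "tree_sum (\<lambda>x. of_bool (x \<in> H)) t = (\<Sum>x\<in>?D. real (count ?F x))"
    unfolding tree_sum_of_bool_mem size_multiset_overloaded_eq by simp
  also have "\<dots> \<le> (\<Sum>x\<in>?D. 1 + real (count ?F x) * (real (count ?F x) - 1))"
    by (intro sum_mono pair)
  also have "\<dots> = real (card ?D) + (\<Sum>x\<in>?D. real (count ?F x) * (real (count ?F x) - 1))"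
    by (simp add: sum.distrib)
  also have "card ?D \<le> num_distinct t"
    unfolding num_distinct_def by (intro card_mono) auto
  also have "(\<Sum>x\<in>?D. real (count ?F x) * (real (count ?F x) - 1)) \<le>
      (\<Sum>x\<in>A. real (count ?F x) * (real (count ?F x) - 1))"
    using assms by (intro sum_mono2 pair) auto
  finally show ?thesis by simp
qed

lemma rrt_mean_markov:
  assumes "n \<ge> 1" "c > 0" "\<And>t. num_vertices t = n \<Longrightarrow> 0 \<le> f t"
  shows "rrt_mean n (\<lambda>t. of_bool (c \<le> f t)) \<le> rrt_mean n f / c"
proof -
  have "rrt_mean n (\<lambda>t. of_bool (c \<le> f t)) \<le> rrt_mean n (\<lambda>t. f t * (1 / c))"
    using assms by (intro rrt_mean_mono) auto
  then show ?thesis by (simp only: rrt_mean_cmult_right) simp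
qed

lemma rrt_mean_tree_sum_chebyshev:
  assumes g: "\<And>t. 0 \<le> g t" "\<And>t. g t \<le> 1" and "n \<ge> 1" "c > 0"
  shows "rrt_mean n (\<lambda>t. of_bool (c \<le> \<bar>tree_sum g t - fringe_density g * real n\<bar>))
           \<le> 140 * (real n * sqrt (real n)) / c\<^sup>2"
proof -
  have "rrt_mean n (\<lambda>t. of_bool (c \<le> \<bar>tree_sum g t - fringe_density g * real n\<bar>)) =
      rrt_mean n (\<lambda>t. of_bool (c\<^sup>2 \<le> (tree_sum g t - fringe_density g * real (num_vertices t))\<^sup>2))"
    using assms by (intro rrt_mean_cong) (auto simp: abs_le_square_iff[symmetric])
  also have "\<dots> \<le> rrt_mean n (\<lambda>t. (tree_sum g t - fringe_density g * real (num_vertices t))\<^sup>2) / c\<^sup>2"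
    using assms by (intro rrt_mean_markov) auto
  also have "\<dots> \<le> 140 * 1\<^sup>2 * (real n * sqrt (real n)) / c\<^sup>2"
    by (intro divide_right_mono rrt_mean_tree_sum_deviation g \<open>n \<ge> 1\<close>) auto
  finally show ?thesis by simp
qed

lemma fringe_density_mono:
  assumes f: "\<And>t. 0 \<le> f t" "\<And>t. f t \<le> 1" and g: "\<And>t. 0 \<le> g t" "\<And>t. g t \<le> 1"
    and "\<And>k. c * rrt_mean (Suc k) f \<le> rrt_mean (Suc k) g"
  shows "c * fringe_density f \<le> fringe_density g"
proof -
  note sf = summable_fringe_density[OF f] and sg = summable_fringe_density[OF g]
  have "c * fringe_density f = (\<Sum>k. c * (rrt_mean (Suc k) f / (real (Suc k) * real (Suc k + 1))))"
    unfolding fringe_density_def by (rule suminf_mult[OF sf, symmetric])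
  also have "\<dots> \<le> fringe_density g"
    unfolding fringe_density_def
  proof (rule suminf_le[OF _ summable_mult[OF sf] sg])
    fix k
    show "c * (rrt_mean (Suc k) f / (real (Suc k) * real (Suc k + 1))) \<le>
        rrt_mean (Suc k) g / (real (Suc k) * real (Suc k + 1))"
      using divide_right_mono[OF assms(5)[of k], of "real (Suc k) * real (Suc k + 1)"] by simp
  qed
  finally show ?thesis .
qed

lemma rrt_mean_of_bool_size:
  assumes "n \<ge> 1"
  shows "rrt_mean n (\<lambda>t. of_bool (P (num_vertices t))) = of_bool (P n)"
proof -
  have "rrt_mean n (\<lambda>t. of_bool (P (num_vertices t))) = rrt_mean n (\<lambda>t. of_bool (P n))"
    by (rule rrt_mean_cong[OF assms]) simp
  then show ?thesis by (simp only: rrt_mean_const)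
qed

lemma fringe_density_size_ge:
  assumes "k \<ge> 1"
  shows "fringe_density (\<lambda>t. of_bool (k \<le> num_vertices t)) = 1 / real k"
proof -
  obtain m where m: "k = Suc m" using assms by (cases k) auto
  let ?f = "\<lambda>j. of_bool (k \<le> Suc j) / (real (Suc j) * real (Suc j + 1))"
  have "(\<lambda>j. ?f (j + m)) sums (1 / real (Suc m))"
    using telescope_sums[of m] by (simp add: m)
  then have "?f sums (1 / real k)"
    by (subst (asm) sums_zero_iff_shift) (auto simp: m)
  then show ?thesis
    unfolding fringe_density_def rrt_mean_of_bool_size[of "Suc _" "\<lambda>n. k \<le> n", simplified]
    by (simp add: sums_iff)
qed

lemma nat_ceiling_ln_bounds:
  fixes a :: real
  assumes "a > 0" "n \<ge> 2" "k = nat \<lceil>ln (real n) / a\<rceil>"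
  shows "k \<ge> 1" "ln (real n) / a \<le> real k" "real k - 1 \<le> ln (real n) / a"
proof -
  have "ln (real n) / a > 0" using assms by simp
  then show "k \<ge> 1" "ln (real n) / a \<le> real k" "real k - 1 \<le> ln (real n) / a"
    unfolding assms(3) by linarith+
qed

lemma polya_count_exp_bound:
  assumes "c18 < a"
  obtains C where "C > 0" "\<And>k. real (polya_count k) \<le> C * exp (a * real k)"
proof -
  from order_tendstoD(2)[OF c18_tendsto assms]
  obtain K where K: "\<And>k. k \<ge> K \<Longrightarrow> ln (real (polya_count k)) / real k < a"
    by (auto simp: eventually_sequentially)
  define C where "C = 1 + (\<Sum>k\<le>K. real (polya_count k))"
  have C: "C \<ge> 1" by (simp add: C_def sum_nonneg)
  have a: "a > 0" using assms c18_pos by linarith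
  have "real (polya_count k) \<le> C * exp (a * real k)" for k
  proof (cases "k \<le> K")
    case True
    then have "real (polya_count k) \<le> (\<Sum>k\<le>K. real (polya_count k))"
      by (intro member_le_sum) auto
    also have "\<dots> \<le> C * 1" by (simp add: C_def)
    also have "\<dots> \<le> C * exp (a * real k)" using C a by (intro mult_left_mono) auto
    finally show ?thesis .
  next
    case False
    then have k: "k \<ge> 1" "real k > 0" by auto
    have "ln (real (polya_count k)) < a * real k" using K[of k] False k by (simp add: divide_less_eq)
    then have "exp (ln (real (polya_count k))) \<le> 1 * exp (a * real k)" by simp
    moreover have "exp (ln (real (polya_count k))) = real (polya_count k)"
      using polya_count_pos[OF k(1)] by simp
    ultimately have "real (polya_count k) \<le> 1 * exp (a * real k)" by simp
    also have "\<dots> \<le> C * exp (a * real k)" using C by (intro mult_right_mono) auto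
    finally show ?thesis .
  qed
  then show ?thesis using that[of C] C by simp
qed

definition asymp_scale :: "nat \<Rightarrow> real" where
  "asymp_scale n = real n / ln (real n)"

lemma asymp_scale_pos: "n \<ge> 2 \<Longrightarrow> asymp_scale n > 0"
  by (simp add: asymp_scale_def)

text \<open>About \<open>ln n / b\<close> sizes are involved, each with at most
  \<open>C * n powr (a / b)\<close> trees, and the exponent is below 1.\<close>

lemma num_small_trees_le:
  assumes "c18 < a" "a < b"
  shows "(\<lambda>n. real (card {t. num_vertices t < nat \<lceil>ln (real n) / b\<rceil>}) / asymp_scale n) \<longlonglongrightarrow> 0"
proof -
  obtain C where C: "C > 0" "\<And>k. real (polya_count k) \<le> C * exp (a * real k)"
    by (rule polya_count_exp_bound[OF assms(1)]) (rule that)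
  have a: "0 < a" "0 < b" using assms c18_pos by linarith+
  have le: "real (card {t. num_vertices t < nat \<lceil>ln (real n) / b\<rceil>}) / asymp_scale n \<le>
      (ln (real n) / b + 1) * C * exp (a / b * ln (real n)) / (real n / ln (real n))" if n: "n \<ge> 2" for n
  proof -
    define k where "k = nat \<lceil>ln (real n) / b\<rceil>"
    note k = nat_ceiling_ln_bounds[OF a(2) n k_def]
    have "{t. num_vertices t < k} = (\<Union>j<k. {t. num_vertices t = j})" by auto
    then have "card {t. num_vertices t < k} \<le> (\<Sum>j<k. polya_count j)"
      unfolding polya_count_def by (simp add: card_UN_le)
    then have "real (card {t. num_vertices t < k}) \<le> (\<Sum>j<k. real (polya_count j))"
      by (simp flip: of_nat_sum)
    also have "\<dots> \<le> (\<Sum>j<k. C * exp (a / b * ln (real n)))"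
    proof (rule sum_mono)
      fix j assume "j \<in> {..<k}"
      then have "real j \<le> real k - 1" by auto
      then have "real j \<le> ln (real n) / b" using k(3) by linarith
      then have "a * real j \<le> a / b * ln (real n)" using a by (simp add: field_simps)
      then have "C * exp (a * real j) \<le> C * exp (a / b * ln (real n))" using C(1) by simp
      with C(2)[of j] show "real (polya_count j) \<le> C * exp (a / b * ln (real n))" by linarith
    qed
    also have "\<dots> = real k * (C * exp (a / b * ln (real n)))" by simp
    also have "\<dots> \<le> (ln (real n) / b + 1) * (C * exp (a / b * ln (real n)))"
      using k(3) C(1) by (intro mult_right_mono) auto
    finally have "real (card {t. num_vertices t < k}) \<le> (ln (real n) / b + 1) * C * exp (a / b * ln (real n))"
      by (simp only: mult.assoc)
    then show ?thesis
      unfolding k_def[symmetric] asymp_scale_def using n by (intro divide_right_mono) auto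
  qed
  have "0 < a / b" "a / b < 1" using a assms by auto
  then have lim: "(\<lambda>n. (ln (real n) / b + 1) * C * exp (a / b * ln (real n)) / (real n / ln (real n))) \<longlonglongrightarrow> 0"
    using a by real_asymp
  show ?thesis
  proof (rule tendsto_sandwich[OF _ _ tendsto_const lim])
    show "\<forall>\<^sub>F n in sequentially. 0 \<le> real (card {t. num_vertices t < nat \<lceil>ln (real n) / b\<rceil>}) / asymp_scale n"
      using eventually_ge_at_top[of 2] by eventually_elim (use asymp_scale_pos in \<open>force intro: divide_nonneg_pos\<close>)
  qed (use le in \<open>auto intro: eventually_sequentiallyI[of 2]\<close>)
qed

lemma chebyshev_scale_tendsto:
  assumes "\<eta> > 0"
  shows "(\<lambda>n. 140 * (real n * sqrt (real n)) / (\<eta> * asymp_scale n)\<^sup>2) \<longlonglongrightarrow> 0"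
  unfolding asymp_scale_def using assms by real_asymp

lemma num_distinct_upper:
  assumes "c18 < d"
  shows "\<forall>\<^sub>F n in sequentially. rrt_mean n (\<lambda>t. real (num_distinct t)) \<le> d * asymp_scale n"
    and "(\<lambda>n. rrt_mean n (\<lambda>t. of_bool (d * asymp_scale n < real (num_distinct t)))) \<longlonglongrightarrow> 0"
proof -
  \<comment> \<open>\<open>a\<close> is the growth rate used to count small trees and
    \<open>b\<close> sets the size threshold. Half of the gap \<open>d - b\<close> pays for the
    small shapes, half for the deviation of the number of large fringe subtrees.\<close>
  obtain b where b: "c18 < b" "b < d" using dense[OF assms] by auto
  obtain a where a: "c18 < a" "a < b" using dense[OF b(1)] by auto
  have b0: "b > 0" using b c18_pos by linarith
  define \<eta> where "\<eta> = (d - b) / 2"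
  have \<eta>: "\<eta> > 0" using b by (simp add: \<eta>_def)
  define k where "k n = nat \<lceil>ln (real n) / b\<rceil>" for n
  define S where "S n = real (card {t. num_vertices t < k n})" for n
  define h where "h n t = (of_bool (k n \<le> num_vertices t) :: real)" for n t
  have h: "0 \<le> h n t" "h n t \<le> 1" for n t by (auto simp: h_def)
  have small: "\<forall>\<^sub>F n in sequentially. S n \<le> \<eta> * asymp_scale n"
  proof -
    have "\<forall>\<^sub>F n in sequentially. S n / asymp_scale n < \<eta>"
      using order_tendstoD(2)[OF num_small_trees_le[OF a] \<eta>] by (simp add: S_def k_def)
    with eventually_ge_at_top[of 2] show ?thesis
    proof eventually_elim
      case (elim n)
      then show ?case using asymp_scale_pos[of n] by (simp add: divide_less_eq)
    qed
  qed
  have le: "real (num_distinct t) \<le> S n + tree_sum (h n) t" for n t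
    unfolding S_def h_def[abs_def] by (rule num_distinct_le)
  have density: "fringe_density (h n) * real n \<le> b * asymp_scale n" if n: "n \<ge> 2" for n
  proof -
    note k = nat_ceiling_ln_bounds[OF b0 n k_def]
    have "ln (real n) > 0" using n by simp
    then have "1 / real (k n) \<le> b / ln (real n)"
      using k b0 by (simp add: field_simps)
    then have "1 / real (k n) * real n \<le> b / ln (real n) * real n" by (rule mult_right_mono) simp
    then show ?thesis
      unfolding h_def[abs_def] fringe_density_size_ge[OF k(1)] by (simp add: asymp_scale_def)
  qed
  have "filterlim asymp_scale at_top sequentially" unfolding asymp_scale_def by real_asymp
  then have "\<forall>\<^sub>F n in sequentially. 1 / \<eta> \<le> asymp_scale n" by (simp add: filterlim_at_top)
  with small eventually_ge_at_top[of 2]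
  show "\<forall>\<^sub>F n in sequentially. rrt_mean n (\<lambda>t. real (num_distinct t)) \<le> d * asymp_scale n"
  proof eventually_elim
    case (elim n)
    have "rrt_mean n (\<lambda>t. real (num_distinct t)) \<le> rrt_mean n (\<lambda>t. S n + tree_sum (h n) t)"
      using elim by (intro rrt_mean_mono le) auto
    also have "\<dots> = S n + rrt_mean n (tree_sum (h n))" by (simp add: rrt_mean_add rrt_mean_const)
    also have "rrt_mean n (tree_sum (h n)) \<le> real n * fringe_density (h n) + 1"
      using rrt_mean_tree_sum_bound[of "h n" 1 n] h elim by (simp add: abs_le_iff)
    also have "real n * fringe_density (h n) \<le> b * asymp_scale n"
      using density[of n] elim by (simp add: mult.commute)
    also have "1 \<le> \<eta> * asymp_scale n" using elim \<eta> by (simp add: divide_le_eq mult.commute)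
    finally have "rrt_mean n (\<lambda>t. real (num_distinct t)) \<le> \<eta> * asymp_scale n + (b * asymp_scale n + \<eta> * asymp_scale n)"
      using elim by simp
    then show ?case by (simp add: \<eta>_def algebra_simps)
  qed
  show "(\<lambda>n. rrt_mean n (\<lambda>t. of_bool (d * asymp_scale n < real (num_distinct t)))) \<longlonglongrightarrow> 0"
  proof (rule tendsto_sandwich[OF _ _ tendsto_const chebyshev_scale_tendsto[OF \<eta>]])
    show "\<forall>\<^sub>F n in sequentially. 0 \<le> rrt_mean n (\<lambda>t. of_bool (d * asymp_scale n < real (num_distinct t)))"
      by (rule eventually_sequentiallyI[of 1]) (rule rrt_mean_nonneg, auto)
    show "\<forall>\<^sub>F n in sequentially. rrt_mean n (\<lambda>t. of_bool (d * asymp_scale n < real (num_distinct t))) \<le>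
        140 * (real n * sqrt (real n)) / (\<eta> * asymp_scale n)\<^sup>2"
      using small eventually_ge_at_top[of 2]
    proof eventually_elim
      case (elim n)
      have "of_bool (d * asymp_scale n < real (num_distinct t)) \<le>
          (of_bool (\<eta> * asymp_scale n \<le> \<bar>tree_sum (h n) t - fringe_density (h n) * real n\<bar>) :: real)" for t
      proof (cases "d * asymp_scale n < real (num_distinct t)")
        case True
        have "d * asymp_scale n = \<eta> * asymp_scale n + (b * asymp_scale n + \<eta> * asymp_scale n)"
          by (simp add: \<eta>_def algebra_simps)
        then have "\<eta> * asymp_scale n \<le> \<bar>tree_sum (h n) t - fringe_density (h n) * real n\<bar>"
          using True le[of t n] density[of n] elim by linarith
        then show ?thesis by simp
      qed simp
      then have "rrt_mean n (\<lambda>t. of_bool (d * asymp_scale n < real (num_distinct t))) \<le>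
          rrt_mean n (\<lambda>t. of_bool (\<eta> * asymp_scale n \<le> \<bar>tree_sum (h n) t - fringe_density (h n) * real n\<bar>))"
        using elim by (intro rrt_mean_mono) auto
      also have "\<dots> \<le> 140 * (real n * sqrt (real n)) / (\<eta> * asymp_scale n)\<^sup>2"
        using elim \<eta> asymp_scale_pos[of n] by (intro rrt_mean_tree_sum_chebyshev h) auto
      finally show ?case .
    qed
  qed
qed

text \<open>The gap \<open>a0 - a\<close> absorbs the factor \<open>num_vertices t\<close> of
  \<open>tree_prob_eq\<close>.\<close>

lemma tree_prob_le:
  assumes "a < a0" "a0 * real (num_vertices t) \<le> tree_sum toll t"
  shows "tree_prob t \<le> exp (- (a * real (num_vertices t))) / (a0 - a)"
proof -
  define k where "k = real (num_vertices t)"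
  have "(a0 - a) * k \<le> exp ((a0 - a) * k)" using exp_ge_add_one_self[of "(a0 - a) * k"] by linarith
  then have "k \<le> exp ((a0 - a) * k) / (a0 - a)" using assms(1) by (simp add: field_simps)
  moreover have "exp (- tree_sum toll t) \<le> exp (- (a0 * k))" using assms(2) by (simp add: k_def)
  ultimately have "k * exp (- tree_sum toll t) \<le> exp ((a0 - a) * k) / (a0 - a) * exp (- (a0 * k))"
    using assms(1) by (intro mult_mono) auto
  also have "\<dots> = exp (- (a * k)) / (a0 - a)"
    by (simp add: exp_add[symmetric] algebra_simps)
  finally show ?thesis by (simp add: tree_prob_eq k_def)
qed

lemma sum_tree_prob: "n \<ge> 1 \<Longrightarrow> (\<Sum>t\<in>{t. num_vertices t = n}. tree_prob t) = 1"
  using rrt_mean_eq_sum[of n "\<lambda>_. 1"] by (simp add: rrt_mean_const)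

text \<open>One factor is bounded pointwise by \<open>tree_prob_le\<close>; the other sums to 1 over
  each size, which leaves a geometric series.\<close>

lemma sum_tree_prob_square_le:
  assumes a: "0 < a" "a < a0" and "k \<ge> 1"
    and A: "A = {t. k \<le> num_vertices t \<and> num_vertices t \<le> n \<and> a0 * real (num_vertices t) \<le> tree_sum toll t}"
  shows "(\<Sum>t\<in>A. (tree_prob t)\<^sup>2) \<le> exp (- (a * real k)) / ((a0 - a) * (1 - exp (- a)))"
proof -
  have fin: "finite A" by (rule finite_subset[OF _ finite_utrees_le[of n]]) (auto simp: A)
  define r where "r = exp (- a)"
  have r: "0 < r" "r < 1" using a by (simp_all add: r_def)
  have rpow: "exp (- (a * real j)) = r ^ j" for j
    by (simp add: r_def exp_of_nat_mult[symmetric] mult.commute)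
  have "(\<Sum>t\<in>A. (tree_prob t)\<^sup>2) \<le> (\<Sum>t\<in>A. tree_prob t * (r ^ num_vertices t / (a0 - a)))"
    unfolding power2_eq_square rpow[symmetric]
    using a by (intro sum_mono mult_left_mono tree_prob_le tree_prob_nonneg) (auto simp: A)
  also have "\<dots> \<le> (\<Sum>t\<in>{t. num_vertices t \<in> {k..n}}. tree_prob t * (r ^ num_vertices t / (a0 - a)))"
    using a r tree_prob_nonneg
    by (intro sum_mono2 finite_subset[OF _ finite_utrees_le[of n]]) (auto simp: A)
  also have "{t. num_vertices t \<in> {k..n}} = (\<Union>j\<in>{k..n}. {t. num_vertices t = j})" by auto
  also have "(\<Sum>t\<in>\<dots>. tree_prob t * (r ^ num_vertices t / (a0 - a))) =
      (\<Sum>j\<in>{k..n}. \<Sum>t\<in>{t. num_vertices t = j}. tree_prob t * (r ^ num_vertices t / (a0 - a)))"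
    by (rule sum.UNION_disjoint) (auto simp: finite_utrees)
  also have "\<dots> = (\<Sum>j\<in>{k..n}. (\<Sum>t\<in>{t. num_vertices t = j}. tree_prob t) * (r ^ j / (a0 - a)))"
    unfolding sum_distrib_right by (intro sum.cong) auto
  also have "\<dots> = (\<Sum>j\<in>{k..n}. r ^ j / (a0 - a))"
    using \<open>k \<ge> 1\<close> by (intro sum.cong) (auto simp: sum_tree_prob)
  also have "\<dots> = (\<Sum>j\<in>{k..n}. r ^ j) / (a0 - a)" by (rule sum_divide_distrib[symmetric])
  also have "\<dots> \<le> (r ^ k / (1 - r)) / (a0 - a)"
  proof (rule divide_right_mono)
    show "(\<Sum>j\<in>{k..n}. r ^ j) \<le> r ^ k / (1 - r)"
    proof (cases "k \<le> n")
      case True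
      have "(1 - r) * (\<Sum>j\<in>{k..n}. r ^ j) \<le> r ^ k"
        unfolding sum_gp_multiplied[OF True] using r by simp
      then show ?thesis using r by (simp add: field_simps)
    qed (use r in simp)
  qed (use a in simp)
  finally show ?thesis by (simp add: rpow r_def[symmetric] mult.commute)
qed

lemma num_distinct_lower:
  assumes "0 < d" "d < c17"
  shows "(\<lambda>n. rrt_mean n (\<lambda>t. of_bool (real (num_distinct t) < d * asymp_scale n))) \<longlonglongrightarrow> 0"
proof -
  \<comment> \<open>Roles in the chain \<open>d < d1 < d2 < b < a < a0 < c17\<close>:
    \<open>a0\<close> defines typical shapes, \<open>a\<close> is the decay rate of their
    probabilities, \<open>b\<close> sets the size threshold, \<open>d2\<close> bounds the number of
    typical large fringe subtrees. The gap \<open>d2 - d1\<close> pays for fluctuations,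
    \<open>d1 - d\<close> for coinciding pairs.\<close>
  obtain d1 where d1: "d < d1" "d1 < c17" using dense[OF assms(2)] by auto
  obtain d2 where d2: "d1 < d2" "d2 < c17" using dense[OF d1(2)] by auto
  obtain b where b: "d2 < b" "b < c17" using dense[OF d2(2)] by auto
  obtain a where a: "b < a" "a < c17" using dense[OF b(2)] by auto
  obtain a0 where a0: "a < a0" "a0 < c17" using dense[OF a(2)] by auto
  have pos: "0 < b" "0 < a" "0 < a0" "0 < d2" using assms d1 d2 b a a0 by linarith+
  \<comment> \<open>The share of typical trees to be demanded at each large size: below 1, yet with
    \<open>c * b\<close> above \<open>d2\<close>.\<close>
  define c where "c = (d2 / b + 1) / 2"
  have c: "c < 1" "d2 < c * b" "0 < c" using pos b by (simp_all add: c_def field_simps)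
  define k where "k n = nat \<lceil>ln (real n) / b\<rceil>" for n
  define H where "H n = {t. k n \<le> num_vertices t \<and> a0 * real (num_vertices t) \<le> tree_sum toll t}" for n
  define h where "h n t = (of_bool (t \<in> H n) :: real)" for n t
  have h: "0 \<le> h n t" "h n t \<le> 1" for n t by (auto simp: h_def)
  define A where "A n = {t. k n \<le> num_vertices t \<and> num_vertices t \<le> n \<and>
      a0 * real (num_vertices t) \<le> tree_sum toll t}" for n
  define X where "X x t = real (count (fringes t) x) * (real (count (fringes t) x) - 1)" for x t
  define D where "D n t = (\<Sum>x\<in>A n. X x t)" for n t
  define C where "C = 1 / ((a0 - a) * (1 - exp (- a)))"
  have finA: "finite (A n)" for n by (rule finite_subset[OF _ finite_utrees_le[of n]]) (auto simp: A_def)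
  have X: "0 \<le> X x t" for x t unfolding X_def by (cases "count (fringes t) x") auto
  have ge: "tree_sum (h n) t \<le> real (num_distinct t) + D n t" if "num_vertices t = n" for n t
    unfolding D_def X_def h_def[abs_def]
    using that num_vertices_fringes_le[of _ t] by (intro num_distinct_ge finA) (auto simp: A_def H_def)
  have k_at_top: "filterlim k at_top sequentially"
    unfolding k_def using pos(1) by real_asymp

  \<comment> \<open>The right side is \<open>C * n powr (2 - a / b)\<close>; because
    \<open>a / b > 1\<close> it is negligible against \<open>n / ln n\<close>.\<close>
  have pairs: "rrt_mean n (D n) \<le> C * (real n)\<^sup>2 * exp (- (a / b * ln (real n)))" if n: "n \<ge> 2" for n
  proof -
    note k = nat_ceiling_ln_bounds[OF pos(1) n k_def]
    have "rrt_mean n (D n) = (\<Sum>x\<in>A n. rrt_mean n (X x))"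
      unfolding D_def by (rule rrt_mean_sum)
    also have "\<dots> \<le> (\<Sum>x\<in>A n. (tree_prob x)\<^sup>2 * (real n)\<^sup>2)"
      unfolding X_def power_mult_distrib[symmetric] using n by (intro sum_mono rrt_mean_pairs_le) auto
    also have "\<dots> = (\<Sum>x\<in>A n. (tree_prob x)\<^sup>2) * (real n)\<^sup>2" by (rule sum_distrib_right[symmetric])
    also have "\<dots> \<le> (exp (- (a * real (k n))) / ((a0 - a) * (1 - exp (- a)))) * (real n)\<^sup>2"
      by (intro mult_right_mono sum_tree_prob_square_le[OF pos(2) a0(1) k(1) A_def]) auto
    also have "\<dots> = C * (real n)\<^sup>2 * exp (- (a * real (k n)))" by (simp add: C_def)
    also have "\<dots> \<le> C * (real n)\<^sup>2 * exp (- (a / b * ln (real n)))"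
    proof -
      have "a * (ln (real n) / b) \<le> a * real (k n)" using k(2) pos by (intro mult_left_mono) auto
      moreover have "0 \<le> C" using a0 pos by (simp add: C_def)
      ultimately show ?thesis by (intro mult_left_mono) auto
    qed
    finally show ?thesis .
  qed

  have density: "\<forall>\<^sub>F n in sequentially. d2 * asymp_scale n \<le> fringe_density (h n) * real n"
  proof -
    have "\<forall>\<^sub>F m in sequentially. rrt_mean m (\<lambda>t. of_bool (tree_sum toll t < a0 * real (num_vertices t))) < 1 - c"
      using order_tendstoD(2)[OF tree_sum_toll_deviation[OF a0(2)], of "1 - c"] c by simp
    then obtain m0 where m0: "\<And>m. m \<ge> m0 \<Longrightarrow>
        rrt_mean m (\<lambda>t. of_bool (tree_sum toll t < a0 * real (num_vertices t))) < 1 - c"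
      by (auto simp: eventually_sequentially)
    have "\<forall>\<^sub>F n in sequentially. m0 \<le> k n" using k_at_top by (simp add: filterlim_at_top)
    moreover have "(\<lambda>n. c * (real n / (ln (real n) / b + 1)) / (real n / ln (real n))) \<longlonglongrightarrow> c * b"
      using pos(1) by real_asymp
    then have "\<forall>\<^sub>F n in sequentially. d2 < c * (real n / (ln (real n) / b + 1)) / (real n / ln (real n))"
      by (rule order_tendstoD(1)) (rule c)
    ultimately show ?thesis using eventually_ge_at_top[of 2]
    proof eventually_elim
      case (elim n)
      note k = nat_ceiling_ln_bounds[OF pos(1) elim(3) k_def]
      have "d2 * asymp_scale n \<le> c * (real n / (ln (real n) / b + 1))"
        using elim(2) asymp_scale_pos[OF elim(3)] unfolding asymp_scale_def[symmetric]
        by (simp only: pos_less_divide_eq less_imp_le)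
      also have "\<dots> \<le> c * (real n / real (k n))"
        using k c by (intro mult_left_mono divide_left_mono) auto
      also have "\<dots> = c * fringe_density (\<lambda>t. of_bool (k n \<le> num_vertices t)) * real n"
        by (simp add: fringe_density_size_ge[OF k(1)])
      also have "c * fringe_density (\<lambda>t. of_bool (k n \<le> num_vertices t)) \<le> fringe_density (h n)"
      proof (rule fringe_density_mono)
        fix j
        have "c * rrt_mean (Suc j) (\<lambda>t. of_bool (k n \<le> num_vertices t)) = c * of_bool (k n \<le> Suc j)"
          by (simp add: rrt_mean_of_bool_size[of "Suc j" "\<lambda>m. k n \<le> m"])
        \<comment> \<open>The threshold \<open>k n\<close> has passed \<open>m0\<close>, so at every
          size from it on a tree is typical with probability at least \<open>c\<close>.\<close>
        also have "\<dots> \<le> rrt_mean (Suc j) (h n)"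
        proof (cases "k n \<le> Suc j")
          case True
          have "rrt_mean (Suc j) (h n) =
              rrt_mean (Suc j) (\<lambda>t. 1 - of_bool (tree_sum toll t < a0 * real (num_vertices t)))"
            using True by (intro rrt_mean_cong) (auto simp: h_def H_def)
          also have "\<dots> \<ge> c"
            using m0[of "Suc j"] True elim(1) by (simp add: rrt_mean_diff rrt_mean_const)
          finally show ?thesis using True by simp
        qed (simp add: rrt_mean_nonneg h)
        finally show "c * rrt_mean (Suc j) (\<lambda>t. of_bool (k n \<le> num_vertices t)) \<le> rrt_mean (Suc j) (h n)" .
      qed (use h in auto)
      finally show ?case by (simp add: mult_right_mono)
    qed
  qed

  define \<eta> \<theta> where "\<eta> = d2 - d1" and "\<theta> = d1 - d"
  have \<eta>: "\<eta> > 0" "\<theta> > 0" using d1 d2 by (simp_all add: \<eta>_def \<theta>_def)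
  have "a / b > 1" using a pos by simp
  then have "(\<lambda>n. C * (real n)\<^sup>2 * exp (- (a / b * ln (real n))) / (\<theta> * (real n / ln (real n)))) \<longlonglongrightarrow> 0"
    using \<eta>(2) by real_asymp
  from tendsto_add[OF chebyshev_scale_tendsto[OF \<eta>(1)] this[folded asymp_scale_def]]
  have lim: "(\<lambda>n. 140 * (real n * sqrt (real n)) / (\<eta> * asymp_scale n)\<^sup>2 +
      C * (real n)\<^sup>2 * exp (- (a / b * ln (real n))) / (\<theta> * asymp_scale n)) \<longlonglongrightarrow> 0"
    by simp
  show ?thesis
  proof (rule tendsto_sandwich[OF _ _ tendsto_const lim])
    show "\<forall>\<^sub>F n in sequentially. 0 \<le> rrt_mean n (\<lambda>t. of_bool (real (num_distinct t) < d * asymp_scale n))"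
      by (rule eventually_sequentiallyI[of 1]) (rule rrt_mean_nonneg, auto)
    show "\<forall>\<^sub>F n in sequentially. rrt_mean n (\<lambda>t. of_bool (real (num_distinct t) < d * asymp_scale n)) \<le>
        140 * (real n * sqrt (real n)) / (\<eta> * asymp_scale n)\<^sup>2 +
        C * (real n)\<^sup>2 * exp (- (a / b * ln (real n))) / (\<theta> * asymp_scale n)"
      using density eventually_ge_at_top[of 2]
    proof eventually_elim
      case (elim n)
      have n: "n \<ge> 1" using elim by simp
      \<comment> \<open>Too few distinct shapes force either a deviation of the number of typical
        fringe subtrees or many coinciding pairs; Chebyshev and Markov treat these two.\<close>
      have "of_bool (real (num_distinct t) < d * asymp_scale n) \<le>
          (of_bool (\<eta> * asymp_scale n \<le> \<bar>tree_sum (h n) t - fringe_density (h n) * real n\<bar>) +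
          of_bool (\<theta> * asymp_scale n \<le> D n t) :: real)" if t: "num_vertices t = n" for t
      proof (cases "real (num_distinct t) < d * asymp_scale n \<and> D n t < \<theta> * asymp_scale n")
        case True
        have "d2 * asymp_scale n = d * asymp_scale n + \<theta> * asymp_scale n + \<eta> * asymp_scale n"
          by (simp add: \<eta>_def \<theta>_def algebra_simps)
        then have "\<eta> * asymp_scale n \<le> \<bar>tree_sum (h n) t - fringe_density (h n) * real n\<bar>"
          using True ge[OF t] elim by linarith
        then show ?thesis by simp
      qed auto
      then have "rrt_mean n (\<lambda>t. of_bool (real (num_distinct t) < d * asymp_scale n)) \<le>
          rrt_mean n (\<lambda>t. of_bool (\<eta> * asymp_scale n \<le> \<bar>tree_sum (h n) t - fringe_density (h n) * real n\<bar>)) +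
          rrt_mean n (\<lambda>t. of_bool (\<theta> * asymp_scale n \<le> D n t))"
        unfolding rrt_mean_add[symmetric] by (rule rrt_mean_mono[OF n])
      also have "\<dots> \<le> 140 * (real n * sqrt (real n)) / (\<eta> * asymp_scale n)\<^sup>2 + rrt_mean n (D n) / (\<theta> * asymp_scale n)"
        using elim \<eta> asymp_scale_pos[of n] n X
        by (intro add_mono rrt_mean_tree_sum_chebyshev rrt_mean_markov h) (auto simp: D_def intro!: sum_nonneg)
      also have "rrt_mean n (D n) / (\<theta> * asymp_scale n) \<le>
          C * (real n)\<^sup>2 * exp (- (a / b * ln (real n))) / (\<theta> * asymp_scale n)"
        using pairs[of n] elim \<eta> asymp_scale_pos[of n] by (intro divide_right_mono) auto
      finally show ?case by simp
    qed
  qed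
qed

text \<open>Follows from the bound in probability: the count is nonnegative, and a constant
  \<open>e\<close> slightly above \<open>d\<close> makes up for the exceptional event.\<close>

lemma num_distinct_lower_mean:
  assumes "0 < d" "d < c17"
  shows "\<forall>\<^sub>F n in sequentially. d * asymp_scale n \<le> rrt_mean n (\<lambda>t. real (num_distinct t))"
proof -
  obtain e where e: "d < e" "e < c17" using dense[OF assms(2)] by auto
  define p where "p n = rrt_mean n (\<lambda>t. of_bool (real (num_distinct t) < e * asymp_scale n))" for n
  have "p \<longlonglongrightarrow> 0" unfolding p_def using e assms by (intro num_distinct_lower) auto
  then have "\<forall>\<^sub>F n in sequentially. p n < 1 - d / e"
    using e assms by (intro order_tendstoD(2)) auto
  with eventually_ge_at_top[of 2] show ?thesis
  proof eventually_elim
    case (elim n)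
    have "d * asymp_scale n = e * asymp_scale n * (d / e)" using e assms by simp
    also have "\<dots> \<le> e * asymp_scale n * (1 - p n)"
      using elim e assms asymp_scale_pos[of n] by (intro mult_left_mono) auto
    also have "\<dots> = rrt_mean n (\<lambda>t. e * asymp_scale n * (1 - of_bool (real (num_distinct t) < e * asymp_scale n)))"
      by (simp add: rrt_mean_cmult rrt_mean_diff rrt_mean_const p_def)
    also have "\<dots> \<le> rrt_mean n (\<lambda>t. real (num_distinct t))"
      using elim by (intro rrt_mean_mono) auto
    finally show ?case .
  qed
qed

section \<open>From bounds for each constant to error sequences\<close>

lemma smallo_one_iff: "(\<epsilon> :: nat \<Rightarrow> real) \<in> o(\<lambda>_. 1) \<longleftrightarrow> \<epsilon> \<longlonglongrightarrow> 0"
  using smalloD_tendsto[of \<epsilon> sequentially "\<lambda>_. 1"] smalloI_tendsto[of \<epsilon> "\<lambda>_. 1" sequentially] by auto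

text \<open>The witness is the relative error itself, clipped at 0; the bounds for all
  \<open>d < c\<close> force it to vanish.\<close>

lemma asymptotic_lower_bound:
  fixes E s :: "nat \<Rightarrow> real"
  assumes c: "c > 0" and s: "\<forall>\<^sub>F n in sequentially. s n > 0"
    and lower: "\<And>d. 0 < d \<Longrightarrow> d < c \<Longrightarrow> \<forall>\<^sub>F n in sequentially. d * s n \<le> E n"
  shows "\<exists>\<epsilon>\<in>o(\<lambda>_. 1). \<forall>\<^sub>F n in sequentially. c * s n * (1 + \<epsilon> n) \<le> E n"
proof -
  define \<epsilon> where "\<epsilon> n = min 0 (E n / (c * s n) - 1)" for n
  have "\<epsilon> \<longlonglongrightarrow> 0"
  proof (rule order_tendstoI)
    fix u :: real assume "u < 0"
    \<comment> \<open>The maximum with 1/2 keeps \<open>d\<close> positive for very negative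
      \<open>u\<close>.\<close>
    define d where "d = c * max (1 / 2) (1 + u / 2)"
    have d: "0 < d" "d < c" using c \<open>u < 0\<close> by (simp_all add: d_def)
    from lower[OF d] s show "\<forall>\<^sub>F n in sequentially. u < \<epsilon> n"
    proof eventually_elim
      case (elim n)
      have "d / c \<le> E n / (c * s n)"
        using elim c by (simp add: field_simps)
      moreover have "d / c > 1 + u" using c \<open>u < 0\<close> by (simp add: d_def)
      ultimately show ?case using \<open>u < 0\<close> by (simp add: \<epsilon>_def)
    qed
  qed (auto simp: \<epsilon>_def intro!: always_eventually)
  moreover have "\<forall>\<^sub>F n in sequentially. c * s n * (1 + \<epsilon> n) \<le> E n"
    using s
  proof eventually_elim
    case (elim n)
    have "c * s n * (1 + \<epsilon> n) \<le> c * s n * (E n / (c * s n))"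
      using elim c by (intro mult_left_mono) (auto simp: \<epsilon>_def)
    also have "\<dots> = E n" using elim c by simp
    finally show ?case .
  qed
  ultimately show ?thesis using smallo_one_iff by blast
qed

lemma asymptotic_upper_bound:
  fixes E s :: "nat \<Rightarrow> real"
  assumes c: "c > 0" and s: "\<forall>\<^sub>F n in sequentially. s n > 0"
    and upper: "\<And>d. c < d \<Longrightarrow> \<forall>\<^sub>F n in sequentially. E n \<le> d * s n"
  shows "\<exists>\<delta>\<in>o(\<lambda>_. 1). \<forall>\<^sub>F n in sequentially. E n \<le> c * s n * (1 + \<delta> n)"
proof -
  define \<delta> where "\<delta> n = max 0 (E n / (c * s n) - 1)" for n
  have "\<delta> \<longlonglongrightarrow> 0"
  proof (rule order_tendstoI)
    fix u :: real assume "0 < u"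
    define d where "d = c * (1 + u / 2)"
    have d: "c < d" using c \<open>0 < u\<close> by (simp add: d_def)
    from upper[OF d] s show "\<forall>\<^sub>F n in sequentially. \<delta> n < u"
    proof eventually_elim
      case (elim n)
      have "E n / (c * s n) \<le> d / c"
        using elim c by (simp add: field_simps)
      moreover have "d / c < 1 + u" using c \<open>0 < u\<close> by (simp add: d_def)
      ultimately show ?case using \<open>0 < u\<close> by (simp add: \<delta>_def)
    qed
  qed (auto simp: \<delta>_def intro!: always_eventually)
  moreover have "\<forall>\<^sub>F n in sequentially. E n \<le> c * s n * (1 + \<delta> n)"
    using s
  proof eventually_elim
    case (elim n)
    have "E n = c * s n * (E n / (c * s n))" using elim c by simp
    also have "\<dots> \<le> c * s n * (1 + \<delta> n)"
      using elim c by (intro mult_left_mono) (auto simp: \<delta>_def)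
    finally show ?case .
  qed
  ultimately show ?thesis using smallo_one_iff by blast
qed

text \<open>Passes from a null sequence for each fixed tolerance to one tolerance sequence: take
  nearly the least \<open>e\<close> with \<open>bad n e \<le> e\<close>, so that
  \<open>\<eta> n\<close> also bounds \<open>bad n (\<eta> n)\<close>.\<close>

lemma diagonal_null_sequence:
  fixes bad :: "nat \<Rightarrow> real \<Rightarrow> real"
  assumes "\<And>n. bad n 1 \<le> 1" "\<And>n e. 0 \<le> bad n e"
    and null: "\<And>e. 0 < e \<Longrightarrow> e < 1 \<Longrightarrow> (\<lambda>n. bad n e) \<longlonglongrightarrow> 0"
  obtains \<eta> where "\<eta> \<longlonglongrightarrow> 0" "(\<lambda>n. bad n (\<eta> n)) \<longlonglongrightarrow> 0"
proof -
  define T where "T n = {e. 0 < e \<and> e \<le> 1 \<and> bad n e \<le> e}" for n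
  have T: "T n \<noteq> {}" "bdd_below (T n)" for n
  proof -
    show "T n \<noteq> {}" using assms(1)[of n] by (auto simp: T_def intro!: exI[of _ 1])
    show "bdd_below (T n)" by (rule bdd_belowI[of _ 0]) (auto simp: T_def)
  qed
  \<comment> \<open>The infimum may fail to be attained; the slack tends to 0. \<open>T n\<close>
    contains 1 because \<open>bad n 1 \<le> 1\<close>.\<close>
  have "\<exists>e\<in>T n. e < Inf (T n) + 1 / real (Suc n)" for n
    using cInf_lessD[OF T(1)[of n], of "Inf (T n) + 1 / real (Suc n)"] by auto
  then obtain \<eta> where \<eta>: "\<And>n. \<eta> n \<in> T n" "\<And>n. \<eta> n < Inf (T n) + 1 / real (Suc n)" by metis
  have lim: "\<eta> \<longlonglongrightarrow> 0"
  proof (rule order_tendstoI)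
    fix u :: real assume "0 < u"
    define e where "e = min (1 / 2) (u / 2)"
    have e: "0 < e" "e < 1" using \<open>0 < u\<close> by (auto simp: e_def)
    have "(\<lambda>n. 1 / real (Suc n)) \<longlonglongrightarrow> 0" by real_asymp
    then have "\<forall>\<^sub>F n in sequentially. 1 / real (Suc n) < u / 2"
      using \<open>0 < u\<close> by (intro order_tendstoD(2)) auto
    with order_tendstoD(2)[OF null[OF e] e(1)] show "\<forall>\<^sub>F n in sequentially. \<eta> n < u"
    proof eventually_elim
      case (elim n)
      then have "e \<in> T n" using e by (simp add: T_def)
      then have "Inf (T n) \<le> e" using T(2) by (rule cInf_lower)
      then show ?case using \<eta>(2)[of n] elim(2) by (simp add: e_def)
    qed
  next
    fix u :: real assume "u < 0"
    then show "\<forall>\<^sub>F n in sequentially. u < \<eta> n"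
      using \<eta>(1) by (auto simp: T_def intro!: always_eventually intro: less_trans)
  qed
  have "(\<lambda>n. bad n (\<eta> n)) \<longlonglongrightarrow> 0"
    by (rule tendsto_sandwich[OF _ _ tendsto_const lim])
       (use \<eta>(1) assms(2) in \<open>auto simp: T_def intro!: always_eventually\<close>)
  with lim show ?thesis by (rule that)
qed

section \<open>Translation to the probability space and conclusion\<close>

lemma expectation_num_fringe:
  assumes "n \<ge> 1"
  shows "measure_pmf.expectation (random_recursive_tree n) (\<lambda>p. real (num_fringe n p)) =
    rrt_mean n (\<lambda>t. real (num_distinct t))"
  unfolding random_recursive_tree_def rrt_mean_def
  by (subst integral_pmf_of_set)
     (use assms in \<open>auto simp: recursive_trees_nonempty finite_recursive_trees card_recursive_trees
        num_fringe_eq sum_divide_distrib intro!: sum.cong\<close>)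

lemma prob_num_fringe:
  assumes "n \<ge> 1"
  shows "measure_pmf.prob (random_recursive_tree n) {p. P (num_fringe n p)} =
    rrt_mean n (\<lambda>t. of_bool (P (num_distinct t)))"
proof -
  have "(\<Sum>p\<in>recursive_trees n. of_bool (P (num_distinct (fringe n p 1)))) =
      (\<Sum>p\<in>recursive_trees n. of_bool (P (num_fringe n p)) :: real)"
    using assms by (intro sum.cong) (auto simp: num_fringe_eq)
  also have "\<dots> = real (card (recursive_trees n \<inter> {p. P (num_fringe n p)}))"
    by (rule sum_of_bool_eq) (simp_all add: finite_recursive_trees)
  finally show ?thesis
    by (simp add: random_recursive_tree_def rrt_mean_def measure_pmf_of_set recursive_trees_nonempty
        finite_recursive_trees card_recursive_trees)
qed

theorem theorem16:
  shows
    "(\<exists>\<epsilon> \<delta> :: nat \<Rightarrow> real. \<epsilon> \<in> o(\<lambda>_. 1) \<and> \<delta> \<in> o(\<lambda>_. 1) \<and>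
       (\<forall>\<^sub>F n in sequentially.
          c17 * (real n / ln (real n)) * (1 + \<epsilon> n)
            \<le> measure_pmf.expectation (random_recursive_tree n) (\<lambda>p. real (num_fringe n p)) \<and>
          measure_pmf.expectation (random_recursive_tree n) (\<lambda>p. real (num_fringe n p))
            \<le> c18 * (real n / ln (real n)) * (1 + \<delta> n))) \<and>
     (\<exists>\<epsilon> \<delta> :: nat \<Rightarrow> real. \<epsilon> \<in> o(\<lambda>_. 1) \<and> \<delta> \<in> o(\<lambda>_. 1) \<and>
       (\<lambda>n. measure_pmf.prob (random_recursive_tree n)
          {p. c17 * (real n / ln (real n)) * (1 + \<epsilon> n) \<le> real (num_fringe n p) \<and>
              real (num_fringe n p) \<le> c18 * (real n / ln (real n)) * (1 + \<delta> n)})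
         \<longlonglongrightarrow> 1)"
  unfolding asymp_scale_def[symmetric]
proof
  let ?E = "\<lambda>n. measure_pmf.expectation (random_recursive_tree n) (\<lambda>p. real (num_fringe n p))"
  have s: "\<forall>\<^sub>F n in sequentially. asymp_scale n > 0"
    using asymp_scale_pos by (auto intro: eventually_sequentiallyI[of 2])
  obtain \<epsilon> where \<epsilon>: "\<epsilon> \<in> o(\<lambda>_. 1)"
      "\<forall>\<^sub>F n in sequentially. c17 * asymp_scale n * (1 + \<epsilon> n) \<le> rrt_mean n (\<lambda>t. real (num_distinct t))"
    using asymptotic_lower_bound[OF c17_pos s num_distinct_lower_mean] by blast
  obtain \<delta> where \<delta>: "\<delta> \<in> o(\<lambda>_. 1)"
      "\<forall>\<^sub>F n in sequentially. rrt_mean n (\<lambda>t. real (num_distinct t)) \<le> c18 * asymp_scale n * (1 + \<delta> n)"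
    using asymptotic_upper_bound[OF c18_pos s num_distinct_upper(1)] by blast
  have "\<forall>\<^sub>F n in sequentially. c17 * asymp_scale n * (1 + \<epsilon> n) \<le> ?E n \<and> ?E n \<le> c18 * asymp_scale n * (1 + \<delta> n)"
    using \<epsilon>(2) \<delta>(2) eventually_ge_at_top[of 1] by eventually_elim (simp add: expectation_num_fringe)
  with \<epsilon>(1) \<delta>(1) show "\<exists>\<epsilon> \<delta> :: nat \<Rightarrow> real. \<epsilon> \<in> o(\<lambda>_. 1) \<and> \<delta> \<in> o(\<lambda>_. 1) \<and>
      (\<forall>\<^sub>F n in sequentially. c17 * asymp_scale n * (1 + \<epsilon> n) \<le> ?E n \<and> ?E n \<le> c18 * asymp_scale n * (1 + \<delta> n))"
    by blast
next
  \<comment> \<open>One tolerance serves both sides; the diagonal sequence then enters as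
    \<open>- \<eta> n\<close> below and as \<open>\<eta> n\<close> above.\<close>
  define good where "good n e N \<longleftrightarrow>
      c17 * asymp_scale n * (1 - e) \<le> real N \<and> real N \<le> c18 * asymp_scale n * (1 + e)" for n e and N :: nat
  define bad where "bad n e = 1 - measure_pmf.prob (random_recursive_tree n) {p. good n e (num_fringe n p)}" for n e
  have "(\<lambda>n. bad n e) \<longlonglongrightarrow> 0" if e: "0 < e" "e < 1" for e
  proof -
    have d: "0 < c17 * (1 - e)" "c17 * (1 - e) < c17" "c18 < c18 * (1 + e)"
      using e c17_pos c18_pos by simp_all
    from tendsto_add[OF num_distinct_lower[OF d(1,2)] num_distinct_upper(2)[OF d(3)]]
    have lim: "(\<lambda>n. rrt_mean n (\<lambda>t. of_bool (real (num_distinct t) < c17 * (1 - e) * asymp_scale n)) +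
        rrt_mean n (\<lambda>t. of_bool (c18 * (1 + e) * asymp_scale n < real (num_distinct t)))) \<longlonglongrightarrow> 0"
      by simp
    have "bad n e \<le> rrt_mean n (\<lambda>t. of_bool (real (num_distinct t) < c17 * (1 - e) * asymp_scale n)) +
        rrt_mean n (\<lambda>t. of_bool (c18 * (1 + e) * asymp_scale n < real (num_distinct t)))" if "n \<ge> 1" for n
    proof -
      have "bad n e = rrt_mean n (\<lambda>t. 1 - of_bool (good n e (num_distinct t)))"
        by (simp add: bad_def prob_num_fringe[OF that] rrt_mean_diff rrt_mean_const)
      also have "\<dots> \<le> rrt_mean n (\<lambda>t. of_bool (real (num_distinct t) < c17 * (1 - e) * asymp_scale n) +
          of_bool (c18 * (1 + e) * asymp_scale n < real (num_distinct t)))"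
        by (rule rrt_mean_mono[OF that]) (auto simp: good_def mult_ac not_le)
      finally show ?thesis by (simp only: rrt_mean_add)
    qed
    then show ?thesis
      by (intro tendsto_sandwich[OF _ _ tendsto_const lim])
         (auto simp: bad_def intro!: always_eventually eventually_sequentiallyI[of 1])
  qed
  then obtain \<eta> where \<eta>: "\<eta> \<longlonglongrightarrow> 0" "(\<lambda>n. bad n (\<eta> n)) \<longlonglongrightarrow> 0"
    using diagonal_null_sequence[of bad] by (auto simp: bad_def)
  have "(\<lambda>n. 1 - bad n (\<eta> n)) \<longlonglongrightarrow> 1" using tendsto_diff[OF tendsto_const \<eta>(2), of 1] by simp
  moreover have "(\<lambda>n. - \<eta> n) \<longlonglongrightarrow> 0" using tendsto_minus[OF \<eta>(1)] by simp
  ultimately show "\<exists>\<epsilon> \<delta> :: nat \<Rightarrow> real. \<epsilon> \<in> o(\<lambda>_. 1) \<and> \<delta> \<in> o(\<lambda>_. 1) \<and>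
      (\<lambda>n. measure_pmf.prob (random_recursive_tree n)
          {p. c17 * asymp_scale n * (1 + \<epsilon> n) \<le> real (num_fringe n p) \<and>
              real (num_fringe n p) \<le> c18 * asymp_scale n * (1 + \<delta> n)}) \<longlonglongrightarrow> 1"
    using \<eta>(1) by (intro exI[of _ "\<lambda>n. - \<eta> n"] exI[of _ \<eta>]) (simp add: smallo_one_iff bad_def good_def)
qed

end
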